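(* Let $\mathbb{K}$ be a field. Two sharp tridiagonal systems over $\mathbb{K}$ (on possibly different vector spaces) are isomorphic if and only if they have the same parameter array.
   Context: Let $\mathbb{K}$ be a field and $V$ a vector space over $\mathbb{K}$ with finite positive dimension. $\mathrm{End}(V)$ is the $\mathbb{K}$-algebra of all $\mathbb{K}$-linear maps $V\to V$, with identity $I$. An eigenspace of $A\in\mathrm{End}(V)$ is a nonzero subspace of the form $\{v\in V\mid Av=\theta v\}$ with $\theta\in\mathbb{K}$; $A$ is diagonalizable if $V$ is spanned by the eigenspaces of $A$. A tridiagonal pair on $V$ is an ordered pair $A,A^*\in\mathrm{End}(V)$ (here $A^*$ is just a second linear map, not an adjoint) such that: (i) each of $A,A^*$ is diagonalizable; (ii) there is an ordering $\{V_i\}_{i=0}^d$ of the eigenspaces of $A$ with $A^*V_i\subseteq V_{i-1}+V_i+V_{i+1}$ for $0\le i\le d$, where $V_{-1}=0=V_{d+1}$; (iii) there is an ordering $\{V^*_i\}_{i=0}^\delta$ of the eigenspaces of $A^*$ with $AV^*_i\subseteq V^*_{i-1}+V^*_i+V^*_{i+1}$ for $0\le i\le\delta$, where $V^*_{-1}=0=V^*_{\delta+1}$; (iv) there is no subspace $W$ of $V$ with $AW\subseteq W$, $A^*W\subseteq W$, $W\ne0$, $W\ne V$. Orderings as in (ii), (iii) are called standard. It is known that $d=\delta$ and that, for $0\le i\le d$, the spaces $V_i,V_{d-i},V^*_i,V^*_{d-i}$ have the same dimension, denoted $\rho_i$. The pair is sharp if $\rho_0=1$. For a diagonalizable map with eigenspaces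 $V_0,\dots,V_d$, the primitive idempotent for $V_i$ is the linear map $E_i$ acting as the identity on $V_i$ and as $0$ on $V_j$ for $j\ne i$. An ordering of primitive idempotents is standard if the corresponding ordering of eigenspaces is. A tridiagonal system on $V$ (over $\mathbb{K}$) is a sequence $\Phi=(A;\{E_i\}_{i=0}^d;A^*;\{E^*_i\}_{i=0}^d)$ where $A,A^*$ is a tridiagonal pair on $V$ and $\{E_i\}_{i=0}^d$ (resp. $\{E^*_i\}_{i=0}^d$) is a standard ordering of the primitive idempotents of $A$ (resp. $A^*$). $\Phi$ is sharp if $A,A^*$ is sharp. Let $\theta_i$ (resp. $\theta^*_i$) be the eigenvalue of $A$ (resp. $A^*$) on $E_iV$ (resp. $E^*_iV$). Parameter array. For $0\le i\le d$ put $U_i=(E^*_0V+\cdots+E^*_iV)\cap(E_iV+\cdots+E_dV)$. It is known that $V=U_0+\cdots+U_d$ (direct sum), $U_0=E^*_0V$, $\dim U_i=\rho_i$, $(A-\theta_iI)U_i\subseteq U_{i+1}$ and $(A^*-\theta^*_iI)U_i\subseteq U_{i-1}$, where $U_{-1}=0=U_{d+1}$. If $\Phi$ is sharp then $\dim U_0=1$, and for $0\le i\le d$ the space $U_0$ is invariant under $$(A^*-\theta^*_1I)(A^*-\theta^*_2I)\cdots(A^*-\theta^*_iI)(A-\theta_{i-1}I)\cdots(A-\theta_1I)(A-\theta_0I);$$ let $\zeta_i$ be the corresponding eigenvalue (so $\zeta_0=1$). The sequence $\{\zeta_i\}_{i=0}^d$ is the split sequence of $\Phi$, and the parameter array of $\Phi$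 is $(\{\theta_i\}_{i=0}^d;\{\theta^*_i\}_{i=0}^d;\{\zeta_i\}_{i=0}^d)$. It is defined only for sharp $\Phi$. Tridiagonal systems $\Phi=(A;\{E_i\}_{i=0}^d;A^*;\{E^*_i\}_{i=0}^d)$ on $V$ and $\Phi'=(A';\{E'_i\}_{i=0}^d;A^{*\prime};\{E^{*\prime}_i\}_{i=0}^d)$ on $V'$ are isomorphic if there is an isomorphism of $\mathbb{K}$-vector spaces $\gamma:V\to V'$ with $\gamma A=A'\gamma$, $\gamma A^*=A^{*\prime}\gamma$, and $\gamma E_i=E'_i\gamma$, $\gamma E^*_i=E^{*\prime}_i\gamma$ for $0\le i\le d$. *)

theory Defs
  imports HOL.Vector_Spaces "HOL-Library.Set_Algebras"
begin

text \<open>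
  A vector space is a type together with a scalar multiplication over a type of class
  \<open>field\<close>, as in \<^theory>\<open>HOL.Vector_Spaces\<close>. A sum of subspaces is the elementwise sum of sets
  from \<^theory>\<open>HOL-Library.Set_Algebras\<close>.
\<close>

text \<open>
  The data \<open>(A; {E\<^sub>i}\<^sub>i\<^sub>\<le>\<^sub>d; A\<^sup>*; {E\<^sup>*\<^sub>i}\<^sub>i\<^sub>\<le>\<^sub>d)\<close>. Only the values of \<open>idem\<close> and \<open>dual_idem\<close> at indices
  up to \<open>diam\<close> are part of the system; no definition looks at the others.
\<close>

record 'v td_data =
  diam :: nat
  endo :: "'v \<Rightarrow> 'v"
  idem :: "nat \<Rightarrow> 'v \<Rightarrow> 'v"
  dual_endo :: "'v \<Rightarrow> 'v"
  dual_idem :: "nat \<Rightarrow> 'v \<Rightarrow> 'v"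

definition comp_list :: "('v \<Rightarrow> 'v) list \<Rightarrow> 'v \<Rightarrow> 'v" where
  "comp_list fs = foldr (\<circ>) fs id"

context vector_space
begin

definition eigenspaces :: "('b \<Rightarrow> 'b) \<Rightarrow> 'b set set" where
  "eigenspaces A = {W. W \<noteq> {0} \<and> (\<exists>\<theta>. W = {v. A v = \<theta> *s v})}"

definition diagonalizable :: "('b \<Rightarrow> 'b) \<Rightarrow> bool" where
  "diagonalizable A \<longleftrightarrow> span (\<Union>(eigenspaces A)) = UNIV"

text \<open>
  \<open>standard_ordering A B d V\<close>: \<open>V\<^sub>0, \<dots>, V\<^sub>d\<close> lists every eigenspace of \<open>A\<close> exactly once, and \<open>B\<close> acts
  on it in a block tridiagonal way; the conditionals implement \<open>V\<^sub>-\<^sub>1 = 0 = V\<^sub>d\<^sub>+\<^sub>1\<close>.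
\<close>

definition standard_ordering ::
    "('b \<Rightarrow> 'b) \<Rightarrow> ('b \<Rightarrow> 'b) \<Rightarrow> nat \<Rightarrow> (nat \<Rightarrow> 'b set) \<Rightarrow> bool" where
  "standard_ordering A B d V \<longleftrightarrow>
     bij_betw V {..d} (eigenspaces A) \<and>
     (\<forall>i\<le>d. B ` V i \<subseteq>
        (if i = 0 then {0} else V (i - 1)) + V i + (if i = d then {0} else V (i + 1)))"

definition tridiagonal_pair :: "('b \<Rightarrow> 'b) \<Rightarrow> ('b \<Rightarrow> 'b) \<Rightarrow> bool" where
  "tridiagonal_pair A B \<longleftrightarrow>
     Vector_Spaces.linear scale scale A \<and> Vector_Spaces.linear scale scale B \<and>
     diagonalizable A \<and> diagonalizable B \<and>
     (\<exists>d V. standard_ordering A B d V) \<and>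
     (\<exists>\<delta> V. standard_ordering B A \<delta> V) \<and>
     \<not> (\<exists>W. subspace W \<and> A ` W \<subseteq> W \<and> B ` W \<subseteq> W \<and> W \<noteq> {0} \<and> W \<noteq> UNIV)"

text \<open>
  The number \<open>\<rho>\<^sub>0 = dim V\<^sub>0\<close> is the same for all standard orderings (of either map), so it suffices to
  ask for one of them.
\<close>

definition sharp_pair :: "('b \<Rightarrow> 'b) \<Rightarrow> ('b \<Rightarrow> 'b) \<Rightarrow> bool" where
  "sharp_pair A B \<longleftrightarrow>
     tridiagonal_pair A B \<and> (\<exists>d V. standard_ordering A B d V \<and> dim (V 0) = 1)"

definition primitive_idempotent :: "('b \<Rightarrow> 'b) \<Rightarrow> 'b set \<Rightarrow> ('b \<Rightarrow> 'b) \<Rightarrow> bool" where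
  "primitive_idempotent A W E \<longleftrightarrow>
     Vector_Spaces.linear scale scale E \<and>
     (\<forall>v\<in>W. E v = v) \<and>
     (\<forall>W'\<in>eigenspaces A - {W}. \<forall>v\<in>W'. E v = 0)"

definition standard_idempotents ::
    "('b \<Rightarrow> 'b) \<Rightarrow> ('b \<Rightarrow> 'b) \<Rightarrow> nat \<Rightarrow> (nat \<Rightarrow> 'b \<Rightarrow> 'b) \<Rightarrow> bool" where
  "standard_idempotents A B d E \<longleftrightarrow>
     (\<exists>V. standard_ordering A B d V \<and> (\<forall>i\<le>d. primitive_idempotent A (V i) (E i)))"

definition tridiagonal_system :: "'b td_data \<Rightarrow> bool" where
  "tridiagonal_system \<Phi> \<longleftrightarrow>
     tridiagonal_pair (endo \<Phi>) (dual_endo \<Phi>) \<and>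
     standard_idempotents (endo \<Phi>) (dual_endo \<Phi>) (diam \<Phi>) (idem \<Phi>) \<and>
     standard_idempotents (dual_endo \<Phi>) (endo \<Phi>) (diam \<Phi>) (dual_idem \<Phi>)"

definition sharp_tridiagonal_system :: "'b td_data \<Rightarrow> bool" where
  "sharp_tridiagonal_system \<Phi> \<longleftrightarrow>
     tridiagonal_system \<Phi> \<and> sharp_pair (endo \<Phi>) (dual_endo \<Phi>)"

text \<open>
  The scalar by which \<open>T\<close> acts on \<open>W\<close>; meaningful if \<open>W\<close> is a nonzero subspace on which \<open>T\<close> acts as a
  scalar.
\<close>

definition eigenvalue_on :: "('b \<Rightarrow> 'b) \<Rightarrow> 'b set \<Rightarrow> 'a" where
  "eigenvalue_on T W = (THE t. \<forall>v\<in>W. T v = t *s v)"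

definition eigval :: "'b td_data \<Rightarrow> nat \<Rightarrow> 'a" where
  "eigval \<Phi> i = eigenvalue_on (endo \<Phi>) (range (idem \<Phi> i))"

definition dual_eigval :: "'b td_data \<Rightarrow> nat \<Rightarrow> 'a" where
  "dual_eigval \<Phi> i = eigenvalue_on (dual_endo \<Phi>) (range (dual_idem \<Phi> i))"

definition split_space :: "'b td_data \<Rightarrow> nat \<Rightarrow> 'b set" where
  "split_space \<Phi> i =
     (\<Sum>j\<in>{0..i}. range (dual_idem \<Phi> j)) \<inter> (\<Sum>j\<in>{i..diam \<Phi>}. range (idem \<Phi> j))"

definition shift :: "('b \<Rightarrow> 'b) \<Rightarrow> 'a \<Rightarrow> 'b \<Rightarrow> 'b" where
  "shift T t v = T v - t *s v"

text \<open>
  The list is, from left to right, the product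
  \<open>(A\<^sup>* - \<theta>\<^sup>*\<^sub>1 I) \<cdots> (A\<^sup>* - \<theta>\<^sup>*\<^sub>i I) (A - \<theta>\<^sub>i\<^sub>-\<^sub>1 I) \<cdots> (A - \<theta>\<^sub>0 I)\<close>, so its last entry is applied first.
\<close>

definition split_seq :: "'b td_data \<Rightarrow> nat \<Rightarrow> 'a" where
  "split_seq \<Phi> i =
     eigenvalue_on
       (comp_list
          (map (\<lambda>j. shift (dual_endo \<Phi>) (dual_eigval \<Phi> j)) [1..<i + 1] @
           map (\<lambda>j. shift (endo \<Phi>) (eigval \<Phi> j)) (rev [0..<i])))
       (split_space \<Phi> 0)"

definition parameter_array :: "'b td_data \<Rightarrow> 'a list \<times> 'a list \<times> 'a list" where
  "parameter_array \<Phi> =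
     (map (eigval \<Phi>) [0..<diam \<Phi> + 1],
      map (dual_eigval \<Phi>) [0..<diam \<Phi> + 1],
      map (split_seq \<Phi>) [0..<diam \<Phi> + 1])"

end

definition td_isomorphic ::
    "('k::field \<Rightarrow> 'v::ab_group_add \<Rightarrow> 'v) \<Rightarrow> ('k \<Rightarrow> 'w::ab_group_add \<Rightarrow> 'w) \<Rightarrow>
     'v td_data \<Rightarrow> 'w td_data \<Rightarrow> bool" where
  "td_isomorphic s s' \<Phi> \<Phi>' \<longleftrightarrow>
     diam \<Phi> = diam \<Phi>' \<and>
     (\<exists>\<gamma>. Vector_Spaces.linear s s' \<gamma> \<and> bij \<gamma> \<and>
        \<gamma> \<circ> endo \<Phi> = endo \<Phi>' \<circ> \<gamma> \<and>
        \<gamma> \<circ> dual_endo \<Phi> = dual_endo \<Phi>' \<circ> \<gamma> \<and>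
        (\<forall>i\<le>diam \<Phi>. \<gamma> \<circ> idem \<Phi> i = idem \<Phi>' i \<circ> \<gamma> \<and>
                      \<gamma> \<circ> dual_idem \<Phi> i = dual_idem \<Phi>' i \<circ> \<gamma>))"

end

theory Submission
  imports Defs "HOL-Library.Product_Plus"
begin

text \<open>
  Let \<open>v\<close> span \<open>E\<^sup>*\<^sub>0V\<close>. As \<open>E\<^sub>iA\<^sup>*\<^sup>nE\<^sub>j = 0\<close> whenever \<open>n < |i - j|\<close>, linear algebra that involves only the
  eigenvalues rewrites \<open>A\<^sup>pA\<^sup>*\<^sup>nA\<^sup>q\<close> through elements \<open>A\<^sup>rA\<^sup>*\<^sup>nA\<^sup>s\<close> with \<open>r \<le> n\<close> or \<open>s < n\<close>, and dually. It
  follows that the module generated by \<open>v\<close> is spanned by the words \<open>\<dots> A\<^sup>*\<^sup>k A\<^sup>m A\<^sup>*\<^sup>n A\<^sup>p v\<close> with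
  \<open>\<dots> \<le> k \<le> m \<le> n \<le> p\<close>. Replace the powers by products of factors \<open>A - \<theta>\<^sub>iI\<close>, \<open>A\<^sup>* - \<theta>\<^sup>*\<^sub>iI\<close> that move along the
  split spaces \<open>U\<^sub>h\<close>. Then such a word lies in some \<open>U\<^sub>h\<close> with \<open>h > 0\<close>, where \<open>E\<^sub>0\<close> vanishes, or its
  exponents agree in pairs and it equals a product of members of the split sequence times \<open>v\<close>.

  Applied to a pair \<open>(v, w)\<close> in the product of two systems with the same parameter array, this shows
  that the module \<open>M\<close> generated by \<open>(v, w)\<close> is mapped by the pair of idempotents \<open>E\<^sub>0\<close> into the line
  spanned by the image of \<open>(v, w)\<close>. By irreducibility \<open>M\<close> is the graph of an isomorphism.
\<close>

section \<open>Polynomials in an operator and the banded reduction\<close>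

context vector_space
begin

text \<open>The monic polynomial with root list \<open>cs\<close>, evaluated at \<open>T\<close>;
  the head of the list is the factor applied last.\<close>

definition shifts :: "('b \<Rightarrow> 'b) \<Rightarrow> 'a list \<Rightarrow> 'b \<Rightarrow> 'b" where
  "shifts T cs = comp_list (map (shift T) cs)"

lemma shifts_Nil [simp]: "shifts T [] x = x"
  by (simp add: shifts_def comp_list_def)

lemma shifts_Cons [simp]: "shifts T (c # cs) x = T (shifts T cs x) - c *s shifts T cs x"
  by (simp add: shifts_def comp_list_def shift_def)

text \<open>Preimages of subspaces are subspaces. Most span arguments below are reduced to
  generators in this way.\<close>

lemma linear_into_subspace:
  assumes "Vector_Spaces.linear scale scale f" "subspace T" "f ` S \<subseteq> T" "x \<in> span S"
  shows "f x \<in> T"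
proof -
  interpret f: Vector_Spaces.linear scale scale f by fact
  have "span S \<subseteq> f -` T"
    using assms(3) by (intro span_minimal f.subspace_vimage[OF assms(2)]) auto
  then show ?thesis using assms(4) by auto
qed

lemma linear_funpow:
  assumes "Vector_Spaces.linear scale scale T"
  shows "Vector_Spaces.linear scale scale (T ^^ n)"
proof (induction n)
  case 0
  show ?case by unfold_locales simp_all
next
  case (Suc n)
  then show ?case
    using Vector_Spaces.linear_compose[OF Suc assms] by (simp only: funpow.simps)
qed

lemma linear_shifts:
  assumes "Vector_Spaces.linear scale scale T"
  shows "Vector_Spaces.linear scale scale (shifts T cs)"
proof (induction cs)
  case Nil
  show ?case by unfold_locales simp_all
next
  case (Cons c cs)
  interpret T: Vector_Spaces.linear scale scale T by fact
  interpret S: Vector_Spaces.linear scale scale "shifts T cs" by fact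
  show ?case
    by unfold_locales
      (simp_all add: T.add S.add T.scale S.scale algebra_simps scale_left_commute)
qed

lemma shifts_mem:
  assumes "subspace S" "\<And>x. x \<in> S \<Longrightarrow> T x \<in> S" "x \<in> S"
  shows "shifts T cs x \<in> S"
  by (induction cs) (auto simp: assms subspace_diff subspace_scale)

lemma shifts_eigenvector:
  assumes "Vector_Spaces.linear scale scale T" "T x = t *s x"
  shows "shifts T cs x = (\<Prod>c\<leftarrow>cs. t - c) *s x"
proof (induction cs)
  case (Cons c cs)
  interpret T: Vector_Spaces.linear scale scale T by fact
  show ?case
    by (simp add: Cons T.scale assms(2) scale_left_diff_distrib left_diff_distrib mult.commute)
qed simp

lemma funpow_eigenvector:
  assumes "Vector_Spaces.linear scale scale T" "T x = t *s x"
  shows "(T ^^ n) x = t ^ n *s x"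
proof (induction n)
  case (Suc n)
  interpret T: Vector_Spaces.linear scale scale T by fact
  show ?case by (simp add: Suc T.scale assms(2) mult.commute)
qed simp

lemma funpow_orbit_closed: "T ` range (\<lambda>k. (T ^^ k) x) \<subseteq> span (range (\<lambda>k. (T ^^ k) x))"
proof safe
  fix k
  show "T ((T ^^ k) x) \<in> span (range (\<lambda>k. (T ^^ k) x))"
    by (rule span_base, rule range_eqI[of _ _ "Suc k"]) simp
qed

lemma shifts_in_span_funpow:
  assumes "Vector_Spaces.linear scale scale T"
  shows "shifts T cs x \<in> span ((\<lambda>k. (T ^^ k) x) ` {..length cs})"
proof (induction cs)
  case Nil
  show ?case by (auto intro: span_base)
next
  case (Cons c cs)
  let ?S = "\<lambda>n. (\<lambda>k. (T ^^ k) x) ` {..n}"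
  have "T ` ?S (length cs) \<subseteq> ?S (Suc (length cs))"
  proof safe
    fix k assume "k \<le> length cs"
    then show "T ((T ^^ k) x) \<in> ?S (Suc (length cs))"
      by (intro image_eqI[of _ _ "Suc k"]) auto
  qed
  then have "T ` ?S (length cs) \<subseteq> span (?S (Suc (length cs)))"
    using span_superset by blast
  from linear_into_subspace[OF assms subspace_span this Cons]
  have 1: "T (shifts T cs x) \<in> span (?S (Suc (length cs)))" .
  have "span (?S (length cs)) \<subseteq> span (?S (Suc (length cs)))"
    by (intro span_mono image_mono) auto
  with Cons have "shifts T cs x \<in> span (?S (Suc (length cs)))" by blast
  with 1 show ?case by (simp add: span_diff span_scale)
qed

text \<open>With \<open>rev\<close> the newest root stands at the head, so consecutive products
  satisfy T w_j = w_(j+1) + c_j w_j. Together with \<open>shifts_in_span_funpow\<close> this makes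
  the change between powers and products triangular.\<close>

lemma funpow_in_span_shifts:
  assumes "Vector_Spaces.linear scale scale T"
  shows "(T ^^ p) x \<in> span ((\<lambda>j. shifts T (map c (rev [0..<j])) x) ` {..p})"
proof (induction p)
  case 0
  show ?case by (auto intro: span_base)
next
  case (Suc p)
  let ?w = "\<lambda>j. shifts T (map c (rev [0..<j])) x"
  have "T ` ?w ` {..p} \<subseteq> span (?w ` {..Suc p})"
  proof safe
    fix j assume j: "j \<le> p"
    have "T (?w j) = ?w (Suc j) + c j *s ?w j" by simp
    moreover have "?w j \<in> span (?w ` {..Suc p})" "?w (Suc j) \<in> span (?w ` {..Suc p})"
      using j by (intro span_base imageI; simp)+
    ultimately show "T (?w j) \<in> span (?w ` {..Suc p})"
      by (simp only: span_add span_scale)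
  qed
  from linear_into_subspace[OF assms subspace_span this Suc] show ?case by simp
qed

end

text \<open>One half of a tridiagonal system; exchanging the two maps gives the other half. Apart
  from the injectivity of \<open>\<theta>\<close>, everything is an identity between maps and so
  passes to products of spaces. \<open>E_above\<close> lets indices range over all natural
  numbers.\<close>

locale block_tridiagonal = vector_space scale
  for scale :: "'a::field \<Rightarrow> 'b::ab_group_add \<Rightarrow> 'b" (infixr \<open>*s\<close> 75) +
  fixes A C :: "'b \<Rightarrow> 'b" and E :: "nat \<Rightarrow> 'b \<Rightarrow> 'b" and \<theta> :: "nat \<Rightarrow> 'a" and d :: nat
  assumes linear_A: "Vector_Spaces.linear scale scale A"
    and linear_C: "Vector_Spaces.linear scale scale C"
    and linear_E: "Vector_Spaces.linear scale scale (E i)"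
    and sum_E: "(\<Sum>i\<le>d. E i x) = x"
    and E_E: "E i (E j x) = (if i = j then E i x else 0)"
    and E_above: "d < i \<Longrightarrow> E i x = 0"
    and A_E: "A (E i x) = \<theta> i *s E i x"
    and inj_\<theta>: "inj_on \<theta> {..d}"
    and E_C_E: "i + 1 < j \<or> j + 1 < i \<Longrightarrow> E i (C (E j x)) = 0"
begin

sublocale A: Vector_Spaces.linear scale scale A by (rule linear_A)
sublocale C: Vector_Spaces.linear scale scale C by (rule linear_C)
sublocale E: Vector_Spaces.linear scale scale "E i" for i by (rule linear_E)

lemma eq_0_if_E_eq_0: "(\<And>i. i \<le> d \<Longrightarrow> E i x = 0) \<Longrightarrow> x = 0"
  using sum_E[of x] by simp

lemma E_A: "E i (A x) = \<theta> i *s E i x"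
proof -
  have "E i (A x) = E i (A (\<Sum>j\<le>d. E j x))" by (simp add: sum_E)
  also have "\<dots> = (\<Sum>j\<le>d. \<theta> j *s E i (E j x))" by (simp add: A.sum E.sum A_E E.scale)
  also have "\<dots> = (\<Sum>j\<le>d. if j = i then \<theta> i *s E i x else 0)"
    by (intro sum.cong) (auto simp: E_E)
  also have "\<dots> = \<theta> i *s E i x" by (cases "i \<le> d") (simp_all add: E_above)
  finally show ?thesis .
qed

text \<open>Each application of \<open>C\<close> moves a component by at most one index, as one sees
  by inserting the sum of the idempotents between two factors.\<close>

lemma E_funpow_C_E:
  assumes "i + n < j \<or> j + n < i"
  shows "E i ((C ^^ n) (E j x)) = 0"
  using assms
proof (induction n arbitrary: i)
  case 0
  then show ?case by (auto simp: E_E)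
next
  case (Suc n)
  have "E i ((C ^^ Suc n) (E j x)) = E i (C (\<Sum>l\<le>d. E l ((C ^^ n) (E j x))))"
    by (simp add: sum_E)
  also have "\<dots> = (\<Sum>l\<le>d. E i (C (E l ((C ^^ n) (E j x)))))" by (simp add: C.sum E.sum)
  also have "\<dots> = (\<Sum>l\<le>d. 0)"
  proof (intro sum.cong refl)
    fix l
    show "E i (C (E l ((C ^^ n) (E j x)))) = 0"
    proof (cases "i + 1 < l \<or> l + 1 < i")
      case True
      then show ?thesis by (rule E_C_E)
    next
      case False
      with Suc.prems have "l + n < j \<or> j + n < l" by linarith
      from Suc.IH[OF this] show ?thesis by (simp only: C.zero E.zero)
    qed
  qed
  finally show ?case by simp
qed

text \<open>
  The product of the \<open>A - c\<close> removes every component whose eigenvalue is some \<open>c\<close>, so only the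
  components already known to be in \<open>S\<close> and a nonzero multiple of the \<open>i\<close>-th one survive.
\<close>

lemma component_mem:
  assumes S: "subspace S" and x: "shifts A cs x \<in> S" and i: "i \<le> d" "\<theta> i \<notin> set cs"
    and others: "\<And>l. l \<le> d \<Longrightarrow> l \<noteq> i \<Longrightarrow> \<theta> l \<in> set cs \<or> E l x \<in> S"
  shows "E i x \<in> S"
proof -
  define a where "a l = (\<Prod>c\<leftarrow>cs. \<theta> l - c)" for l
  interpret sh: Vector_Spaces.linear scale scale "shifts A cs" by (rule linear_shifts[OF linear_A])
  have "shifts A cs x = (\<Sum>l\<le>d. shifts A cs (E l x))"
    by (simp add: sum_E flip: sh.sum)
  also have "\<dots> = (\<Sum>l\<le>d. a l *s E l x)"
    by (simp add: shifts_eigenvector[OF linear_A A_E] a_def)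
  also have "\<dots> = a i *s E i x + (\<Sum>l\<in>{..d}-{i}. a l *s E l x)"
    using i by (subst sum.remove[of _ i]) auto
  finally have "a i *s E i x = shifts A cs x - (\<Sum>l\<in>{..d}-{i}. a l *s E l x)" by simp
  moreover have "a l *s E l x \<in> S" if "l \<in> {..d}-{i}" for l
  proof (cases "\<theta> l \<in> set cs")
    case True
    then have "a l = 0" by (force simp: a_def prod_list_zero_iff)
    then show ?thesis by (simp add: subspace_0[OF S])
  next
    case False
    then show ?thesis using others[of l] that by (auto intro: subspace_scale[OF S])
  qed
  ultimately have "a i *s E i x \<in> S"
    using x by (auto intro!: subspace_diff[OF S] subspace_sum[OF S])
  moreover have "a i \<noteq> 0" using i by (auto simp: a_def prod_list_zero_iff)
  ultimately show ?thesis using subspace_scale[OF S, of "a i *s E i x" "inverse (a i)"] by simp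
qed

text \<open>Up to a nonzero scalar, \<open>E i\<close> is the product of all A - \<theta>_l with l
  \<noteq> i, hence a polynomial in \<open>A\<close>.\<close>

lemma E_mem_invariant_subspace:
  assumes S: "subspace S" and A: "\<And>x. x \<in> S \<Longrightarrow> A x \<in> S" and x: "x \<in> S"
  shows "E i x \<in> S"
proof (cases "i \<le> d")
  case True
  show ?thesis
  proof (rule component_mem[OF S])
    show "shifts A (map \<theta> (remove1 i [0..<Suc d])) x \<in> S" by (rule shifts_mem[OF S A x])
    show "\<theta> i \<notin> set (map \<theta> (remove1 i [0..<Suc d]))"
      using inj_onD[OF inj_\<theta>] True by (auto simp del: upt_Suc)
  qed (use True in \<open>auto simp del: upt_Suc\<close>)
next
  case False
  then show ?thesis by (simp add: E_above subspace_0[OF S])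
qed

lemma funpow_mem_if_components_mem:
  assumes S: "subspace S" and "\<And>i. i \<le> d \<Longrightarrow> E i x \<in> S"
  shows "(A ^^ p) x \<in> S"
proof -
  interpret p: Vector_Spaces.linear scale scale "A ^^ p" by (rule linear_funpow[OF linear_A])
  have "(A ^^ p) x = (\<Sum>i\<le>d. (A ^^ p) (E i x))" by (simp add: sum_E flip: p.sum)
  also have "\<dots> = (\<Sum>i\<le>d. \<theta> i ^ p *s E i x)"
    by (simp add: funpow_eigenvector[OF linear_A A_E])
  also have "\<dots> \<in> S" by (intro subspace_sum[OF S] subspace_scale[OF S] assms(2)) auto
  finally show ?thesis .
qed

text \<open>
  For \<open>i \<le> j\<close> the components \<open>E\<^sub>l X E\<^sub>j z\<close> with \<open>l < j - n\<close> vanish, those with \<open>l > j\<close> are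
  treated before, and the at most \<open>n\<close> indices \<open>l \<noteq> i\<close> in \<open>{j - n..j}\<close> are removed by a product of
  at most \<open>n\<close> factors \<open>A - \<theta>\<^sub>l\<close>. For \<open>j < i\<close> the analogous interval \<open>{i - n..i - 1}\<close> is shorter,
  which gives the strict inequality \<open>q < n\<close>.
\<close>

lemma banded_reduction:
  assumes X: "Vector_Spaces.linear scale scale X"
    and band: "\<And>i j x. i + n < j \<or> j + n < i \<Longrightarrow> E i (X (E j x)) = 0"
  shows "(A ^^ p) (X ((A ^^ q) z)) \<in> span {(A ^^ p') (X ((A ^^ q') z)) | p' q'. p' \<le> n \<or> q' < n}"
    (is "_ \<in> span ?G")
proof -
  interpret X: Vector_Spaces.linear scale scale X by fact
  let ?S = "span ?G"
  let ?Z = "span (range (\<lambda>q. (A ^^ q) z))"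
  have A_Z: "A x \<in> ?Z" if "x \<in> ?Z" for x
  proof (rule linear_into_subspace[OF linear_A subspace_span _ that])
    show "A ` range (\<lambda>q. (A ^^ q) z) \<subseteq> ?Z" by (rule funpow_orbit_closed)
  qed
  have z: "z \<in> ?Z" by (rule span_base, rule range_eqI[of _ _ 0]) simp
  \<comment> \<open>\<open>E j z\<close> is a combination of vectors A^q z, because it lies in the
    \<open>A\<close>-invariant space generated by z. At most n factors on the left then give
    generators with \<open>p' \<le> n\<close>.\<close>
  have left: "shifts A cs (X (E j z)) \<in> ?S" if cs: "length cs \<le> n" for cs j
  proof (rule linear_into_subspace[where f = "\<lambda>u. shifts A cs (X u)", OF _ subspace_span])
    show "E j z \<in> ?Z" by (rule E_mem_invariant_subspace[OF subspace_span A_Z z])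
    show "Vector_Spaces.linear scale scale (\<lambda>u. shifts A cs (X u))"
      using Vector_Spaces.linear_compose[OF X linear_shifts[OF linear_A]] by (simp add: o_def)
    have "shifts A cs (X ((A ^^ q) z)) \<in> ?S" for q
    proof -
      have "span ((\<lambda>k. (A ^^ k) (X ((A ^^ q) z))) ` {..length cs}) \<subseteq> ?S"
        using cs by (intro span_mono) (auto intro: order_trans)
      with shifts_in_span_funpow[OF linear_A] show ?thesis by blast
    qed
    then show "(\<lambda>u. shifts A cs (X u)) ` range (\<lambda>q. (A ^^ q) z) \<subseteq> ?S" by blast
  qed
  \<comment> \<open>The mirror image: \<open>E i\<close> stays in the span of the vectors A^p (X
    (A^k z)) with the same k < n, which are generators of the second kind.\<close>
  have right: "E i (X (shifts A cs z)) \<in> ?S" if cs: "length cs < n" for cs i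
  proof (rule linear_into_subspace[where f = "\<lambda>u. E i (X u)", OF _ subspace_span _ shifts_in_span_funpow[OF linear_A]])
    show "Vector_Spaces.linear scale scale (\<lambda>u. E i (X u))"
      using Vector_Spaces.linear_compose[OF X linear_E] by (simp add: o_def)
    have "E i (X ((A ^^ k) z)) \<in> ?S" if "k \<le> length cs" for k
    proof -
      let ?T = "span (range (\<lambda>p. (A ^^ p) (X ((A ^^ k) z))))"
      have "E i (X ((A ^^ k) z)) \<in> ?T"
      proof (rule E_mem_invariant_subspace)
        show "A x \<in> ?T" if "x \<in> ?T" for x
        proof (rule linear_into_subspace[OF linear_A subspace_span _ that])
          show "A ` range (\<lambda>p. (A ^^ p) (X ((A ^^ k) z))) \<subseteq> ?T"
            by (rule funpow_orbit_closed)
        qed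
        show "X ((A ^^ k) z) \<in> ?T" by (rule span_base, rule range_eqI[of _ _ 0]) simp
      qed simp
      moreover have "?T \<subseteq> ?S" using le_less_trans[OF that cs] by (intro span_mono) blast
      ultimately show ?thesis by blast
    qed
    then show "(\<lambda>u. E i (X u)) ` (\<lambda>k. (A ^^ k) z) ` {..length cs} \<subseteq> ?S" by blast
  qed
  have main: "E i (X (E j z)) \<in> ?S" if "i \<le> d" "j \<le> d" for i j
    using that
  proof (induction "d - max i j" arbitrary: i j rule: less_induct)
    case less
    \<comment> \<open>Stated for fresh indices with its own hypothesis, because the case j < i uses
      it again for the pair (i, i), whose maximum equals that of (i, j) and which the induction
      hypothesis therefore does not reach.\<close>
    have upper: "E i (X (E j z)) \<in> ?S" if "i \<le> j" "j \<le> d"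
      and IH: "\<And>l. j < l \<Longrightarrow> l \<le> d \<Longrightarrow> E l (X (E j z)) \<in> ?S" for i j
    proof (cases "i + n < j")
      case True
      then show ?thesis by (simp add: band span_zero)
    next
      case False
      let ?ls = "remove1 i [j - n..<Suc j]"
      have i: "i \<in> set [j - n..<Suc j]" using False that by (simp del: upt_Suc)
      show ?thesis
      proof (rule component_mem[OF subspace_span left])
        show "length (map \<theta> ?ls) \<le> n" using i by (simp add: length_remove1 del: upt_Suc)
        show "i \<le> d" using that by simp
        show "\<theta> i \<notin> set (map \<theta> ?ls)"
          using inj_onD[OF inj_\<theta>] that by (auto simp del: upt_Suc)
        fix l assume l: "l \<le> d" "l \<noteq> i"
        consider "l + n < j" | "j < l" | "l \<in> set ?ls" using l by (force simp del: upt_Suc)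
        then show "\<theta> l \<in> set (map \<theta> ?ls) \<or> E l (X (E j z)) \<in> ?S"
          by cases (auto simp: band span_zero IH l simp del: upt_Suc)
      qed
    qed
    have IH: "E k (X (E l z)) \<in> ?S" if "max i j < max k l" "k \<le> d" "l \<le> d" for k l
      using that by (intro less.hyps diff_less_mono2) auto
    show ?case
    proof (cases "i \<le> j")
      case True
      have "E l (X (E j z)) \<in> ?S" if "j < l" "l \<le> d" for l
        using that True less.prems(2) by (intro IH) auto
      with True less.prems(2) show ?thesis by (rule upper)
    next
      case ij: False
      show ?thesis
      proof (cases "j + n < i")
        case True
        then show ?thesis by (simp add: band span_zero)
      next
        case False
        \<comment> \<open>Now the left index is fixed, and the component argument runs on z inside
          the preimage of \<open>?S\<close>.\<close>
        let ?T = "(\<lambda>u. E i (X u)) -` ?S"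
        let ?ls = "remove1 j [i - n..<i]"
        interpret EX: Vector_Spaces.linear scale scale "\<lambda>u. E i (X u)"
          using Vector_Spaces.linear_compose[OF X linear_E] by (simp add: o_def)
        have j: "j \<in> set [i - n..<i]" using False ij by simp
        have "E j z \<in> ?T"
        proof (rule component_mem)
          show "subspace ?T" by (rule EX.subspace_vimage) simp
          have "length (map \<theta> ?ls) < n" using j ij False by (simp add: length_remove1)
          from right[OF this] show "shifts A (map \<theta> ?ls) z \<in> ?T" by simp
          show "j \<le> d" by fact
          show "\<theta> j \<notin> set (map \<theta> ?ls)"
            using inj_onD[OF inj_\<theta>] less.prems by auto
          fix l assume l: "l \<le> d" "l \<noteq> j"
          consider "l + n < i" | "i \<le> l" | "l \<in> set ?ls" using l by force
          then show "\<theta> l \<in> set (map \<theta> ?ls) \<or> E l z \<in> ?T"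
          proof cases
            case 2
            have "E i (X (E l z)) \<in> ?S"
            proof (cases "l = i")
              case True
              have "E k (X (E i z)) \<in> ?S" if "i < k" "k \<le> d" for k
                using that ij less.prems(1) by (intro IH) auto
              with upper[of i i] less.prems(1) True show ?thesis by simp
            next
              case False
              then show ?thesis using 2 l ij less.prems(1) by (intro IH) auto
            qed
            then show ?thesis by simp
          qed (auto simp: band span_zero)
        qed
        then show ?thesis by simp
      qed
    qed
  qed
  \<comment> \<open>Expanding A^p on the left and then A^q on the right into components leaves only
    the vectors treated in \<open>main\<close>.\<close>
  show ?thesis
  proof (rule funpow_mem_if_components_mem[OF subspace_span])
    fix i assume i: "i \<le> d"
    interpret EX: Vector_Spaces.linear scale scale "\<lambda>u. E i (X u)"
      using Vector_Spaces.linear_compose[OF X linear_E] by (simp add: o_def)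
    have "(A ^^ q) z \<in> (\<lambda>u. E i (X u)) -` ?S"
      by (rule funpow_mem_if_components_mem[OF EX.subspace_vimage[OF subspace_span]])
        (simp add: main i)
    then show "E i (X ((A ^^ q) z)) \<in> ?S" by simp
  qed
qed

end

section \<open>Sorted words span an invariant subspace\<close>

text \<open>Irreducibility enters only in \<open>td_irreducible\<close>, since a direct product of
  two systems has to be an instance of this locale.\<close>

locale td_module = vector_space scale +
  P: block_tridiagonal scale A B E \<theta> d +
  D: block_tridiagonal scale B A F \<phi> d
  for scale :: "'a::field \<Rightarrow> 'b::ab_group_add \<Rightarrow> 'b" (infixr \<open>*s\<close> 75)
    and A B :: "'b \<Rightarrow> 'b" and E F :: "nat \<Rightarrow> 'b \<Rightarrow> 'b" and \<theta> \<phi> :: "nat \<Rightarrow> 'a" and d :: nat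
begin

definition letter :: "nat \<Rightarrow> 'b \<Rightarrow> 'b" where
  "letter k = (if even k then A else B)"

text \<open>
  The word with exponents \<open>n\<^sub>k, \<dots>, n\<^sub>1\<close> (outermost first) applied to \<open>v\<close>; its letters alternate, the
  innermost one is \<open>A\<close>, and \<open>c\<close> prescribes the roots of the monic polynomials that take the place of
  the powers.
\<close>

primrec word :: "(nat list \<Rightarrow> nat \<Rightarrow> 'a) \<Rightarrow> 'b \<Rightarrow> nat list \<Rightarrow> 'b" where
  "word c v [] = v"
| "word c v (n # ns) = shifts (letter (length ns)) (map (c ns) (rev [0..<n])) (word c v ns)"

lemma linear_letter: "Vector_Spaces.linear scale scale (letter k)"
  by (simp add: letter_def P.linear_A D.linear_A)

lemma letter_add_2 [simp]: "letter (Suc (Suc k)) = letter k"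
  by (simp add: letter_def)

text \<open>The m-th power of a tridiagonally acting map has bandwidth m; the parity of k selects
  the half of the system to which the banded reduction is applied.\<close>

lemma banded_reduction_letter:
  "(letter k ^^ p) ((letter (Suc k) ^^ m) ((letter k ^^ q) z))
    \<in> span {(letter k ^^ p') ((letter (Suc k) ^^ m) ((letter k ^^ q') z)) | p' q'. p' \<le> m \<or> q' < m}"
proof (cases "even k")
  case True
  then show ?thesis
    using P.banded_reduction[OF linear_funpow[OF P.linear_C] P.E_funpow_C_E]
    by (simp add: letter_def)
next
  case False
  then show ?thesis
    using D.banded_reduction[OF linear_funpow[OF D.linear_C] D.E_funpow_C_E]
    by (simp add: letter_def)
qed

context
  fixes c :: "nat list \<Rightarrow> nat \<Rightarrow> 'a" and v :: 'b
  assumes F0_v: "F 0 v = v"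
begin

text \<open>The exponents of a sorted word weakly decrease from the innermost letter outwards.\<close>

definition words_upto :: "nat \<Rightarrow> nat \<Rightarrow> 'b set" where
  "words_upto k m =
     span (word c v ` {ns. length ns = k \<and> sorted ns \<and> (ns \<noteq> [] \<longrightarrow> hd ns \<le> m)})"

definition words :: "nat \<Rightarrow> 'b set" where
  "words k = span (word c v ` {ns. length ns = k \<and> sorted ns})"

lemma subspace_words_upto [simp]: "subspace (words_upto k m)"
  by (simp add: words_upto_def)

lemma words_upto_mono: "m \<le> m' \<Longrightarrow> words_upto k m \<subseteq> words_upto k m'"
  unfolding words_upto_def by (intro span_mono image_mono) auto

lemma words_upto_subset: "words_upto k m \<subseteq> words k"
  unfolding words_def words_upto_def by (intro span_mono image_mono) auto

lemma word_mem_words_upto: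
  "length ns = k \<Longrightarrow> sorted ns \<Longrightarrow> ns \<noteq> [] \<longrightarrow> hd ns \<le> m \<Longrightarrow> word c v ns \<in> words_upto k m"
  unfolding words_upto_def by (rule span_base) blast

text \<open>By triangularity the power is a combination of products with j \<le> p factors, and
  putting such a j in front keeps the list sorted.\<close>

lemma funpow_word_low:
  assumes "sorted ns" "ns \<noteq> [] \<longrightarrow> p \<le> hd ns"
  shows "(letter (length ns) ^^ p) (word c v ns) \<in> words_upto (Suc (length ns)) p"
proof -
  have sorted: "sorted (j # ns)" if "j \<le> p" for j
    using assms that by (cases ns) auto
  have "word c v (j # ns) \<in> words_upto (Suc (length ns)) p" if "j \<le> p" for j
    using that sorted[OF that] by (intro word_mem_words_upto) auto
  then have "span ((\<lambda>j. shifts (letter (length ns)) (map (c ns) (rev [0..<j])) (word c v ns)) ` {..p})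
      \<subseteq> words_upto (Suc (length ns)) p"
    by (intro span_minimal) auto
  then show ?thesis using funpow_in_span_shifts[OF linear_letter] by blast
qed

text \<open>The vector v has dual index 0, and n factors in \<open>A\<close> raise the dual index by
  at most n.\<close>

lemma dual_component_word_singleton:
  assumes "n < j"
  shows "F j (word c v [n]) = 0"
proof -
  let ?S = "{x. F j x = 0}"
  have "shifts A cs v \<in> ?S" if "length cs \<le> n" for cs
  proof -
    have "(A ^^ k) v \<in> ?S" if "k \<le> length cs" for k
    proof -
      have "F j ((A ^^ k) (F 0 v)) = 0"
        using that assms \<open>length cs \<le> n\<close> by (intro D.E_funpow_C_E) auto
      then show ?thesis by (simp add: F0_v)
    qed
    then have "span ((\<lambda>k. (A ^^ k) v) ` {..length cs}) \<subseteq> ?S"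
      by (intro span_minimal D.E.subspace_kernel) auto
    then show ?thesis using shifts_in_span_funpow[OF P.linear_A] by blast
  qed
  then show ?thesis by (simp add: letter_def)
qed

text \<open>The word has components only for the dual indices 0 to n, so \<open>B\<close> satisfies
  a polynomial of degree at most n + 1 on it. This replaces the banded reduction when there is no
  letter behind \<open>A\<close>.\<close>

lemma dual_funpow_word_singleton:
  "(B ^^ p) (word c v [n]) \<in> span {(B ^^ p') (word c v [n]) | p'. p' \<le> n}" (is "_ \<in> span ?G")
proof (rule D.funpow_mem_if_components_mem[OF subspace_span])
  let ?x = "word c v [n]"
  fix i assume i: "i \<le> d"
  show "F i ?x \<in> span ?G"
  proof (cases "i \<le> n")
    case True
    \<comment> \<open>The cut at d keeps the indices in the range where \<open>\<phi>\<close> is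
      injective. Once i is removed, at most n roots remain.\<close>
    let ?ls = "remove1 i [0..<Suc (min n d)]"
    show ?thesis
    proof (rule D.component_mem[OF subspace_span _ i])
      have "length (map \<phi> ?ls) \<le> n" using True i by (simp add: length_remove1 del: upt_Suc)
      then have "span ((\<lambda>k. (B ^^ k) ?x) ` {..length (map \<phi> ?ls)}) \<subseteq> span ?G"
        by (intro span_mono) (auto simp del: word.simps)
      then show "shifts B (map \<phi> ?ls) ?x \<in> span ?G"
        using shifts_in_span_funpow[OF D.linear_A] by blast
      show "\<phi> i \<notin> set (map \<phi> ?ls)"
        using inj_onD[OF D.inj_\<theta>] i True by (auto simp del: upt_Suc)
      show "\<phi> l \<in> set (map \<phi> ?ls) \<or> F l ?x \<in> span ?G" if "l \<le> d" "l \<noteq> i" for l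
        using that True dual_component_word_singleton[of n l]
        by (cases "l \<le> n") (auto simp: span_zero simp del: upt_Suc word.simps)
    qed
  next
    case False
    then show ?thesis using dual_component_word_singleton[of n i] by (simp add: span_zero del: word.simps)
  qed
qed

text \<open>
  A new outermost letter with exponent \<open>p\<close> in front of a sorted word with outermost exponent \<open>m < p\<close>
  is treated by the banded reduction: either its exponent becomes at most \<open>m\<close>, or the exponent behind
  \<open>m\<close> becomes smaller than \<open>m\<close> and the induction on \<open>m\<close> applies.
\<close>

lemma funpow_words:
  "(\<forall>p. \<forall>x\<in>words k. (letter k ^^ p) x \<in> words_upto (Suc k) p) \<and>
   (0 < k \<longrightarrow> (\<forall>p m. \<forall>x\<in>words_upto k m. (letter k ^^ p) x \<in> words_upto (Suc k) m))"
proof (induction k rule: less_induct)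
  case (less k)
  note IH_k = this
  have linear: "Vector_Spaces.linear scale scale (letter k ^^ p)" for p
    by (rule linear_funpow[OF linear_letter])
  \<comment> \<open>The bound \<open>min p m\<close> serves both conjuncts: it is at most m, and for
    single words it is used with m equal to the outermost exponent and is at most p. The induction
    on m is nested in the one on k.\<close>
  have both: "(letter k ^^ p) x \<in> words_upto (Suc k) (min p m)"
    if "0 < k" "x \<in> words_upto k m" for p m x
    using that(2)
  proof (induction m arbitrary: p x rule: less_induct)
    case (less m)
    note IH_m = less.IH
    have gen: "(letter k ^^ p) (word c v ns) \<in> words_upto (Suc k) (min p m)"
      if ns: "length ns = k" "sorted ns" "hd ns \<le> m" for ns p
    proof -
      obtain n ns' where ns_eq: "ns = n # ns'" using ns \<open>0 < k\<close> by (cases ns) auto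
      consider "n < m" | "p \<le> n" "n = m" | "n = m" "m < p" using ns ns_eq by fastforce
      then show ?thesis
      proof cases
        case 1
        have "word c v ns \<in> words_upto k n"
          using ns by (intro word_mem_words_upto) (auto simp: ns_eq)
        from IH_m[OF 1 this, of p] show ?thesis
          using words_upto_mono[of "min p n" "min p m" "Suc k"] 1 by (auto simp: min_le_iff_disj)
      next
        case 2
        then show ?thesis using funpow_word_low[of ns p] ns ns_eq by auto
      next
        case 3
        have low: "(letter k ^^ p') (word c v ns) \<in> words_upto (Suc k) m" if "p' \<le> m" for p'
          using funpow_word_low[of ns p'] ns that ns_eq 3 words_upto_mono[of p' m "Suc k"] by auto
        have "(letter k ^^ p) (word c v ns) \<in> words_upto (Suc k) m"
        proof (cases ns')
          case Nil
          \<comment> \<open>The word consists of a single letter \<open>A\<close>, so dual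
            components take the place of the banded reduction.\<close>
          then have eq: "ns = [m]" "letter k = B" using 3 ns ns_eq by (auto simp: letter_def)
          have "span {(B ^^ p') (word c v [m]) | p'. p' \<le> m} \<subseteq> words_upto (Suc k) m"
            using low by (intro span_minimal) (auto simp: eq simp del: word.simps)
          then show ?thesis using dual_funpow_word_singleton by (auto simp: eq simp del: word.simps)
        next
          case (Cons q ks)
          \<comment> \<open>Stripping two letters exposes the pattern ?B^p ?C^j ?B^i applied to a
            shorter sorted word, to which the banded reduction applies.\<close>
          define k' where "k' = length ks"
          have k: "k = Suc (Suc k')" using ns ns_eq Cons by (simp add: k'_def)
          let ?z = "word c v ks" and ?B = "letter k'" and ?C = "letter (Suc k')"
          let ?x = "word c v ns'"
          have z: "?z \<in> words k'"
            using ns ns_eq Cons word_mem_words_upto[of ks k' "hd ks"] words_upto_subset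
            by (auto simp: k'_def)
          have reduced: "(?B ^^ p') ((?C ^^ j) ((?B ^^ q') ?z)) \<in> words_upto (Suc k) m"
            if j: "j \<le> m" and "p' \<le> j \<or> q' < j" for p' j q'
          proof -
            have Bz: "(?B ^^ q') ?z \<in> words_upto (Suc k') q'" using IH_k[of k'] k z by auto
            show ?thesis
            proof (cases "q' < j")
              \<comment> \<open>The second conjunct for the shorter words carries the bound q'
                through ?C^j, and q' < m makes the inner induction available.\<close>
              case True
              have "(?C ^^ j) ((?B ^^ q') ?z) \<in> words_upto k q'" using IH_k[of "Suc k'"] k Bz by auto
              from IH_m[OF _ this, of p'] True j show ?thesis
                using words_upto_mono[of "min p' q'" m "Suc k"] by (auto simp: k min_le_iff_disj)
            next
              case False
              with that have p': "p' \<le> j" by simp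
              have "(?C ^^ j) ((?B ^^ q') ?z) \<in> words_upto k j"
                using IH_k[of "Suc k'"] k Bz words_upto_subset by blast
              \<comment> \<open>If p' is at most the outermost exponent, the extended word is sorted
                already; otherwise that exponent is below p' \<le> m and the inner induction
                applies.\<close>
              moreover have "(letter k ^^ p') ` word c v ` {ns. length ns = k \<and> sorted ns \<and> (ns \<noteq> [] \<longrightarrow> hd ns \<le> j)}
                  \<subseteq> words_upto (Suc k) m"
              proof clarify
                fix ms assume ms: "sorted ms" "ms \<noteq> [] \<longrightarrow> hd ms \<le> j" "k = length ms"
                show "(letter (length ms) ^^ p') (word c v ms) \<in> words_upto (Suc (length ms)) m"
                proof (cases "p' \<le> hd ms")
                  case True
                  then show ?thesis
                    using funpow_word_low[of ms p'] ms p' j words_upto_mono[of p' m "Suc k"] by auto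
                next
                  case False
                  have "word c v ms \<in> words_upto k (hd ms)"
                    using ms by (intro word_mem_words_upto) auto
                  with IH_m[of "hd ms" _ p'] False p' j ms show ?thesis
                    using words_upto_mono[of "min p' (hd ms)" m "Suc k"] by auto
                qed
              qed
              ultimately have "(letter k ^^ p') ((?C ^^ j) ((?B ^^ q') ?z)) \<in> words_upto (Suc k) m"
                unfolding words_upto_def[of k j]
                by (rule linear_into_subspace[OF linear subspace_words_upto, rotated])
              then show ?thesis by (simp add: k)
            qed
          qed
          have step: "(?B ^^ p) ((?C ^^ j) ((?B ^^ q') ?z)) \<in> words_upto (Suc k) m" if "j \<le> m" for j q'
          proof -
            have "span {(?B ^^ p') ((?C ^^ j) ((?B ^^ q') ?z)) | p' q'. p' \<le> j \<or> q' < j}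
                \<subseteq> words_upto (Suc k) m"
              using reduced[OF that] by (intro span_minimal subspace_words_upto) blast
            then show ?thesis by (rule subsetD[OF _ banded_reduction_letter])
          qed
          \<comment> \<open>The words contain polynomials instead of powers: first the innermost
            polynomial in \<open>?B\<close> is expanded, afterwards the one in
            \<open>?C\<close>.\<close>
          have step': "(?B ^^ p) ((?C ^^ j) ?x) \<in> words_upto (Suc k) m" if "j \<le> m" for j
          proof (rule linear_into_subspace[where f = "\<lambda>u. (?B ^^ p) ((?C ^^ j) u)", OF _ subspace_words_upto])
            show "Vector_Spaces.linear scale scale (\<lambda>u. (?B ^^ p) ((?C ^^ j) u))"
              using Vector_Spaces.linear_compose[OF linear_funpow linear_funpow, OF linear_letter linear_letter]
              by (simp add: o_def)
            show "?x \<in> span ((\<lambda>i. (?B ^^ i) ?z) ` {..q})"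
              using shifts_in_span_funpow[OF linear_letter, of k' "map (c ks) (rev [0..<q])" ?z]
              by (simp add: Cons k'_def)
          qed (use step[OF that] in auto)
          show ?thesis
          proof (rule linear_into_subspace[OF linear subspace_words_upto])
            show "word c v ns \<in> span ((\<lambda>j. (?C ^^ j) ?x) ` {..m})"
              using shifts_in_span_funpow[OF linear_letter, of "Suc k'" "map (c ns') (rev [0..<m])" ?x]
              by (simp add: ns_eq 3 Cons k'_def)
          qed (use step' k in auto)
        qed
        then show ?thesis using 3 by simp
      qed
    qed
    have "(letter k ^^ p) ` word c v ` {ns. length ns = k \<and> sorted ns \<and> (ns \<noteq> [] \<longrightarrow> hd ns \<le> m)}
        \<subseteq> words_upto (Suc k) (min p m)"
      using gen \<open>0 < k\<close> by auto
    from linear_into_subspace[OF linear subspace_words_upto this] less.prems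
    show ?case by (simp add: words_upto_def)
  qed
  have "(letter k ^^ p) x \<in> words_upto (Suc k) p" if "x \<in> words k" for p x
  proof -
    have "(letter k ^^ p) (word c v ns) \<in> words_upto (Suc k) p"
      if ns: "length ns = k" "sorted ns" for ns
    proof (cases ns)
      case Nil
      then show ?thesis using funpow_word_low[of ns p] ns by simp
    next
      case (Cons n ns')
      then have "(letter k ^^ p) (word c v ns) \<in> words_upto (Suc k) (min p n)"
        using ns by (intro both word_mem_words_upto) auto
      then show ?thesis using words_upto_mono[of "min p n" p "Suc k"] by auto
    qed
    then have "(letter k ^^ p) ` word c v ` {ns. length ns = k \<and> sorted ns} \<subseteq> words_upto (Suc k) p"
      by auto
    from linear_into_subspace[OF linear subspace_words_upto this] that
    show ?thesis by (simp add: words_def)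
  qed
  moreover have "(letter k ^^ p) x \<in> words_upto (Suc k) m" if "0 < k" "x \<in> words_upto k m" for p m x
    using both[OF that, of p] words_upto_mono[of "min p m" m "Suc k"] by auto
  ultimately show ?case by blast
qed

text \<open>The roots \<open>c\<close> are still arbitrary: spanning depends only on the polynomials
  being monic of the right degrees. The choice adapted to the split spaces is
  \<open>root\<close>.\<close>

lemma sorted_words_closed:
  assumes "x \<in> span (word c v ` {ns. sorted ns})"
  shows "letter k x \<in> span (word c v ` {ns. sorted ns})" (is "_ \<in> ?M")
proof -
  have words: "words k \<subseteq> ?M" for k
    unfolding words_def by (intro span_mono image_mono) auto
  have own: "letter (length ns) (word c v ns) \<in> ?M" if "sorted ns" for ns
  proof -
    have "word c v ns \<in> words (length ns)"
      unfolding words_def using that by (intro span_base) auto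
    then have "(letter (length ns) ^^ 1) (word c v ns) \<in> words_upto (Suc (length ns)) 1"
      using funpow_words by blast
    then show ?thesis using words[of "Suc (length ns)"] words_upto_subset[of "Suc (length ns)" 1] by auto
  qed
  have "letter k (word c v ns) \<in> ?M" if "sorted ns" for ns
  proof (cases "even k = even (length ns)")
    case True
    then show ?thesis using own[OF that] by (simp add: letter_def)
  next
    case False
    \<comment> \<open>A leading exponent 0 leaves the vector unchanged and flips the parity, so that
      the other letter becomes the next one.\<close>
    have "letter (length (0 # ns)) (word c v (0 # ns)) \<in> ?M" using that by (intro own) simp
    then show ?thesis using False by (simp add: letter_def)
  qed
  then show ?thesis
    using assms by (intro linear_into_subspace[OF linear_letter subspace_span, of _ "word c v ` {ns. sorted ns}"]) auto
qed

end
end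

section \<open>Words and split spaces\<close>

context td_module
begin

text \<open>The split space \<open>U\<^sub>h\<close>, described by vanishing components.\<close>

definition split :: "nat \<Rightarrow> 'b set" where
  "split h = {x. (\<forall>j>h. F j x = 0) \<and> (\<forall>j<h. E j x = 0)}"

lemma F_A_eq_0:
  assumes "\<And>l. h < l \<Longrightarrow> F l x = 0" "Suc h < j"
  shows "F j (A x) = 0"
proof -
  have "F j (A (F l x)) = 0" for l
    using assms D.E_C_E[of j l x] by (cases "h < l") auto
  moreover have "F j (A x) = (\<Sum>l\<le>d. F j (A (F l x)))"
    by (simp add: D.sum_E flip: D.E.sum P.A.sum)
  ultimately show ?thesis by simp
qed

lemma E_B_eq_0:
  assumes "\<And>l. l < h \<Longrightarrow> E l x = 0" "Suc j < h"
  shows "E j (B x) = 0"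
proof -
  have "E j (B (E l x)) = 0" for l
    using assms P.E_C_E[of j l x] by (cases "l < h") auto
  moreover have "E j (B x) = (\<Sum>l\<le>d. E j (B (E l x)))"
    by (simp add: P.sum_E flip: P.E.sum P.C.sum)
  ultimately show ?thesis by simp
qed

text \<open>\<open>A\<close> extends the dual support by at most one index, and the factor A -
  \<theta>_h removes the component with index h.\<close>

lemma raise_split:
  assumes "x \<in> split h"
  shows "A x - \<theta> h *s x \<in> split (Suc h)"
proof -
  have "F j (A x - \<theta> h *s x) = 0" if "Suc h < j" for j
    using assms F_A_eq_0[of h x j] that by (simp add: split_def D.E.diff D.E.scale)
  moreover have "E j (A x - \<theta> h *s x) = 0" if "j < Suc h" for j
    using assms that by (cases "j = h") (auto simp: split_def P.E.diff P.E.scale P.E_A)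
  ultimately show ?thesis by (simp add: split_def)
qed

lemma lower_split:
  assumes "x \<in> split (Suc h)"
  shows "B x - \<phi> (Suc h) *s x \<in> split h"
proof -
  have "E j (B x - \<phi> (Suc h) *s x) = 0" if "j < h" for j
    using assms E_B_eq_0[of "Suc h" x j] that by (simp add: split_def P.E.diff P.E.scale)
  moreover have "F j (B x - \<phi> (Suc h) *s x) = 0" if "h < j" for j
    using assms that by (cases "j = Suc h") (auto simp: split_def D.E.diff D.E.scale D.E_A)
  ultimately show ?thesis by (simp add: split_def)
qed

lemma lower_split_0:
  assumes "x \<in> split 0"
  shows "B x = \<phi> 0 *s x"
proof -
  have "F j x = 0" if "j \<noteq> 0" for j using assms that by (simp add: split_def)
  then have "F j (B x) = F j (\<phi> 0 *s x)" for j
    by (cases "j = 0") (auto simp: D.E_A D.E.scale)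
  then have "B x - \<phi> 0 *s x = 0" by - (rule D.eq_0_if_E_eq_0, simp add: D.E.diff)
  then show ?thesis by simp
qed

lemma split_above: "d < h \<Longrightarrow> x \<in> split h \<Longrightarrow> x = 0"
  by (rule P.eq_0_if_E_eq_0) (auto simp: split_def)

lemma split_0: "x \<in> split 0 \<longleftrightarrow> F 0 x = x"
proof
  assume x: "x \<in> split 0"
  have "x = (\<Sum>j\<le>d. F j x)" by (simp add: D.sum_E)
  also have "\<dots> = (\<Sum>j\<in>{0}. F j x)"
    using x by (intro sum.mono_neutral_right) (auto simp: split_def)
  finally show "F 0 x = x" by simp
next
  assume "F 0 x = x"
  then have "F j x = 0" if "0 < j" for j
    using D.E_E[of j 0 x] that by simp
  then show "x \<in> split 0" by (simp add: split_def)
qed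

lemma raise_split_power:
  "x \<in> split h \<Longrightarrow> shifts A (map (\<lambda>i. \<theta> (h + i)) (rev [0..<n])) x \<in> split (h + n)"
  by (induction n) (simp_all add: raise_split)

lemma lower_split_power:
  "x \<in> split h \<Longrightarrow> n \<le> h \<Longrightarrow> shifts B (map (\<lambda>i. \<phi> (h - i)) (rev [0..<n])) x \<in> split (h - n)"
proof (induction n)
  case (Suc n)
  then have "shifts B (map (\<lambda>i. \<phi> (h - i)) (rev [0..<n])) x \<in> split (Suc (h - Suc n))" by (simp add: Suc_diff_Suc)
  from lower_split[OF this] show ?case using Suc.prems by (simp add: Suc_diff_Suc)
qed simp

text \<open>
  The index of the split space that contains the word; the truncated subtraction is exact on sorted
  lists.
\<close>

primrec height :: "nat list \<Rightarrow> nat" where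
  "height [] = 0"
| "height (n # ns) = (if even (length ns) then height ns + n else height ns - n)"

text \<open>The eigenvalues met on the walk through the split spaces: \<open>A\<close> climbs from
  the current height, \<open>B\<close> descends from it.\<close>

definition root :: "nat list \<Rightarrow> nat \<Rightarrow> 'a" where
  "root ns i = (if even (length ns) then \<theta> (height ns + i) else \<phi> (height ns - i))"

text \<open>Odd length means that the last letter was a raising one. In a sorted list the next
  exponent is no larger, so the subtraction in \<open>height\<close> is exact.\<close>

lemma height_ge: "odd (length ns) \<Longrightarrow> hd ns \<le> height ns"
  by (cases ns) auto

lemma word_mem_split:
  assumes "F 0 v = v" "sorted ns"
  shows "word root v ns \<in> split (height ns)"
  using assms(2)
proof (induction ns)
  case Nil
  then show ?case using assms(1) by (simp add: split_0)
next
  case (Cons n ns)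
  then have IH: "word root v ns \<in> split (height ns)" by simp
  show ?case
  proof (cases "even (length ns)")
    case True
    then have "root ns = (\<lambda>i. \<theta> (height ns + i))" by (simp add: root_def fun_eq_iff)
    then show ?thesis using raise_split_power[OF IH, of n] True by (simp add: letter_def)
  next
    case False
    then have "n \<le> height ns" using height_ge[of ns] Cons.prems by (cases ns) auto
    moreover have "root ns = (\<lambda>i. \<phi> (height ns - i))" using False by (simp add: root_def fun_eq_iff)
    ultimately show ?thesis using lower_split_power[OF IH, of n] False by (simp add: letter_def)
  qed
qed

text \<open>Descending from height m to 0 uses exactly the factors of the split sequence, in the
  same order.\<close>

lemma map_lower_indices: "map (\<lambda>i. f (m - i)) (rev [0..<m]) = map f [1..<m + 1]"
  by (rule nth_equalityI) (simp_all add: rev_nth del: upt_Suc)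

lemma word_height_0:
  assumes v: "F 0 v = v"
    and eig: "\<And>m. \<exists>z. shifts B (map \<phi> [1..<m + 1]) (shifts A (map \<theta> (rev [0..<m])) v) = z *s v"
    and "sorted ns" "height ns = 0"
  shows "\<exists>s. word root v ns = s *s v"
  using assms(3,4)
proof (induction "length ns" arbitrary: ns rule: less_induct)
  case less
  show ?case
  proof (cases ns)
    case Nil
    then show ?thesis by (auto intro: exI[of _ 1])
  next
    case (Cons n ms)
    show ?thesis
    proof (cases "even (length ms)")
      case True
      with less.prems less.hyps[of ms] show ?thesis by (simp add: Cons)
    next
      case False
      then obtain m ks where ms: "ms = m # ks" by (cases ms) auto
      with False have ks: "even (length ks)" by simp
      \<comment> \<open>The exponents satisfy n \<le> m, and height ks + m - n vanishes; so the
        descent cancels the preceding climb, and \<open>ks\<close> has height 0 too.\<close>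
      have "n = m" "height ks = 0" using less.prems False by (auto simp: Cons ms)
      with less.hyps[of ks] less.prems obtain s where s: "word root v ks = s *s v"
        by (auto simp: Cons ms)
      interpret L: Vector_Spaces.linear scale scale "shifts B cs" for cs
        by (rule linear_shifts[OF D.linear_A])
      interpret R: Vector_Spaces.linear scale scale "shifts A cs" for cs
        by (rule linear_shifts[OF P.linear_A])
      obtain z where "shifts B (map \<phi> [1..<m + 1]) (shifts A (map \<theta> (rev [0..<m])) v) = z *s v"
        using eig by blast
      moreover have "root ks = \<theta>"
        using ks \<open>height ks = 0\<close> by (simp add: root_def fun_eq_iff)
      moreover have "root ms = (\<lambda>i. \<phi> (m - i))"
        using ks \<open>height ks = 0\<close> by (simp add: root_def ms fun_eq_iff)
      then have "map (root ms) (rev [0..<m]) = map \<phi> [1..<m + 1]"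
        by (simp only: map_lower_indices)
      ultimately have "word root v ns = s *s z *s v"
        using ks s \<open>n = m\<close> by (simp add: Cons ms letter_def L.scale R.scale del: upt_Suc)
      then show ?thesis by auto
    qed
  qed
qed

lemma E0_sorted_words:
  assumes v: "F 0 v = v"
    and eig: "\<And>m. \<exists>z. shifts B (map \<phi> [1..<m + 1]) (shifts A (map \<theta> (rev [0..<m])) v) = z *s v"
    and x: "x \<in> span (word root v ` {ns. sorted ns})"
  shows "\<exists>s. E 0 x = s *s E 0 v"
proof -
  have "E 0 (word root v ns) \<in> span {E 0 v}" if "sorted ns" for ns
  proof (cases "height ns = 0")
    case True
    with word_height_0[OF v eig that] obtain s where "word root v ns = s *s v" by blast
    then show ?thesis by (simp add: P.E.scale span_base span_scale)
  next
    case False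
    with word_mem_split[OF v that] show ?thesis by (simp add: split_def span_zero)
  qed
  then have "E 0 x \<in> span {E 0 v}"
    by (intro linear_into_subspace[OF P.linear_E subspace_span _ x]) auto
  then show ?thesis by (auto simp: span_singleton)
qed

end

locale td_irreducible = td_module +
  assumes irreducible:
      "subspace W \<Longrightarrow> (\<And>x. x \<in> W \<Longrightarrow> A x \<in> W) \<Longrightarrow> (\<And>x. x \<in> W \<Longrightarrow> B x \<in> W) \<Longrightarrow> W = {0} \<or> W = UNIV"
    and E0_nonzero: "\<exists>x. E 0 x \<noteq> 0"
begin

text \<open>
  The sum of the spaces \<open>(F\<^sub>0V + \<dots> + F\<^sub>iV) \<inter> (E\<^sub>i\<^sub>+\<^sub>1V + \<dots> + E\<^sub>dV)\<close> is an invariant subspace of the kernel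
  of \<open>E\<^sub>0\<close>.
\<close>

lemma E0_injective:
  assumes "F 0 x = x" "E 0 x = 0"
  shows "x = 0"
proof -
  \<comment> \<open>Unlike in \<open>split i\<close>, the component with index i vanishes as well.
    Raising therefore uses \<theta>_(i+1), while lowering uses \<phi>_i.\<close>
  define X where "X i = {x. (\<forall>j>i. F j x = 0) \<and> (\<forall>j\<le>i. E j x = 0)}" for i
  let ?W = "span (\<Union>i. X i)"
  have X_W: "x \<in> ?W" if "x \<in> X i" for i x using that by (blast intro: span_base)
  have "A ` (\<Union>i. X i) \<subseteq> ?W"
  proof safe
    fix i x assume x: "x \<in> X i"
    have "A x - \<theta> (Suc i) *s x \<in> X (Suc i)"
    proof -
      have "F j (A x - \<theta> (Suc i) *s x) = 0" if "Suc i < j" for j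
        using x F_A_eq_0[of i x j] that by (simp add: X_def D.E.diff D.E.scale)
      moreover have "E j (A x - \<theta> (Suc i) *s x) = 0" if "j \<le> Suc i" for j
        using x that by (cases "j = Suc i") (auto simp: X_def P.E.diff P.E.scale P.E_A)
      ultimately show ?thesis by (simp add: X_def)
    qed
    from span_add[OF X_W[OF this] span_scale[OF X_W[OF x], of "\<theta> (Suc i)"]]
    show "A x \<in> ?W" by simp
  qed
  then have A_W: "A x \<in> ?W" if "x \<in> ?W" for x
    using that by (intro linear_into_subspace[OF P.linear_A subspace_span])
  have "B ` (\<Union>i. X i) \<subseteq> ?W"
  proof safe
    fix i x assume x: "x \<in> X i"
    show "B x \<in> ?W"
    proof (cases i)
      case 0
      then have "x \<in> split 0" using x by (simp add: X_def split_def)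
      then show ?thesis using lower_split_0 X_W[OF x] by (simp add: span_scale)
    next
      case (Suc h)
      have "B x - \<phi> i *s x \<in> X h"
      proof -
        have "E j (B x - \<phi> i *s x) = 0" if "j \<le> h" for j
          using x E_B_eq_0[of "Suc i" x j] that by (simp add: X_def P.E.diff P.E.scale Suc)
        moreover have "F j (B x - \<phi> i *s x) = 0" if "h < j" for j
          using x that by (cases "j = Suc h") (auto simp: X_def D.E.diff D.E.scale D.E_A Suc)
        ultimately show ?thesis by (simp add: X_def)
      qed
      from span_add[OF X_W[OF this] span_scale[OF X_W[OF x], of "\<phi> i"]]
      show ?thesis by simp
    qed
  qed
  then have B_W: "B x \<in> ?W" if "x \<in> ?W" for x
    using that by (intro linear_into_subspace[OF P.linear_C subspace_span])
  have "?W \<subseteq> {x. E 0 x = 0}"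
    by (intro span_minimal P.E.subspace_kernel) (auto simp: X_def)
  with E0_nonzero have "?W \<noteq> UNIV" by auto
  with irreducible[OF subspace_span A_W B_W] have "?W = {0}" by blast
  moreover have "x \<in> X 0" using assms split_0[of x] by (simp add: X_def split_def)
  ultimately show ?thesis using X_W by blast
qed

end

section \<open>The graph of the isomorphism\<close>

definition prod_scale ::
    "('a \<Rightarrow> 'b \<Rightarrow> 'b) \<Rightarrow> ('a \<Rightarrow> 'c \<Rightarrow> 'c) \<Rightarrow> 'a \<Rightarrow> 'b \<times> 'c \<Rightarrow> 'b \<times> 'c" where
  "prod_scale s s' c = map_prod (s c) (s' c)"

lemma prod_scale_Pair [simp]: "prod_scale s s' c (x, y) = (s c x, s' c y)"
  by (simp add: prod_scale_def)

lemma vector_space_prod_scale: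
  assumes "vector_space s" "vector_space s'"
  shows "vector_space (prod_scale s s')"
proof -
  interpret V: vector_space s by fact
  interpret W: vector_space s' by fact
  show ?thesis
    by unfold_locales
      (auto simp: V.scale_right_distrib W.scale_right_distrib
        V.scale_left_distrib W.scale_left_distrib)
qed

lemma linear_map_prod:
  assumes "Vector_Spaces.linear s s f" "Vector_Spaces.linear s' s' g"
  shows "Vector_Spaces.linear (prod_scale s s') (prod_scale s s') (map_prod f g)"
proof -
  interpret f: Vector_Spaces.linear s s f by fact
  interpret g: Vector_Spaces.linear s' s' g by fact
  interpret vector_space "prod_scale s s'"
    by (rule vector_space_prod_scale) unfold_locales
  show ?thesis
    by unfold_locales (auto simp: f.add g.add f.scale g.scale)
qed

text \<open>Both factors have the same eigenvalue sequence, so the paired idempotents still project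
  to eigenvectors of the paired operator.\<close>

lemma block_tridiagonal_map_prod:
  assumes "block_tridiagonal s A C E \<theta> d" "block_tridiagonal s' A' C' E' \<theta> d"
  shows "block_tridiagonal (prod_scale s s') (map_prod A A') (map_prod C C')
           (\<lambda>i. map_prod (E i) (E' i)) \<theta> d"
proof -
  interpret V: block_tridiagonal s A C E \<theta> d by fact
  interpret W: block_tridiagonal s' A' C' E' \<theta> d by fact
  interpret vector_space "prod_scale s s'"
    by (rule vector_space_prod_scale) unfold_locales
  show ?thesis
  proof (intro block_tridiagonal.intro block_tridiagonal_axioms.intro)
    fix i j x
    show "vector_space (prod_scale s s')" by unfold_locales
    show "(\<Sum>i\<le>d. map_prod (E i) (E' i) x) = x"
      by (simp add: prod_eq_iff fst_sum snd_sum V.sum_E W.sum_E)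
    show "map_prod (E i) (E' i) (map_prod (E j) (E' j) x) = (if i = j then map_prod (E i) (E' i) x else 0)"
      by (cases x) (simp add: V.E_E W.E_E zero_prod_def)
    show "d < i \<Longrightarrow> map_prod (E i) (E' i) x = 0"
      by (cases x) (simp add: V.E_above W.E_above zero_prod_def)
    show "map_prod A A' (map_prod (E i) (E' i) x) = prod_scale s s' (\<theta> i) (map_prod (E i) (E' i) x)"
      by (cases x) (simp add: V.A_E W.A_E)
    show "i + 1 < j \<or> j + 1 < i \<Longrightarrow> map_prod (E i) (E' i) (map_prod C C' (map_prod (E j) (E' j) x)) = 0"
      by (cases x) (simp add: V.E_C_E W.E_C_E zero_prod_def)
    show "inj_on \<theta> {..d}" by (rule V.inj_\<theta>)
  qed (intro linear_map_prod V.linear_A W.linear_A V.linear_C W.linear_C V.linear_E W.linear_E)+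
qed

lemma shifts_map_prod:
  assumes "vector_space s" "vector_space s'"
  shows "vector_space.shifts (prod_scale s s') (map_prod f g) cs (x, y) =
    (vector_space.shifts s f cs x, vector_space.shifts s' g cs y)"
proof -
  interpret V: vector_space s by fact
  interpret W: vector_space s' by fact
  interpret vector_space "prod_scale s s'"
    by (rule vector_space_prod_scale) fact+
  show ?thesis by (induction cs) simp_all
qed

text \<open>The kernels and images of the two projections of M are invariant, hence trivial or
  everything. The common scalar z in both halves of the last hypothesis keeps the image of M under
  the pair of first idempotents on one line.\<close>

lemma td_irreducible_isomorphism:
  assumes "td_irreducible s A B E F \<theta> \<phi> d" "td_irreducible s' A' B' E' F' \<theta> \<phi> d"
    and v: "F 0 v = v" "v \<noteq> 0" and w: "F' 0 w = w" "w \<noteq> 0"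
    and eig: "\<And>m. \<exists>z.
       vector_space.shifts s B (map \<phi> [1..<m + 1])
         (vector_space.shifts s A (map \<theta> (rev [0..<m])) v) = s z v \<and>
       vector_space.shifts s' B' (map \<phi> [1..<m + 1])
         (vector_space.shifts s' A' (map \<theta> (rev [0..<m])) w) = s' z w"
  shows "\<exists>\<gamma>. Vector_Spaces.linear s s' \<gamma> \<and> bij \<gamma> \<and> \<gamma> \<circ> A = A' \<circ> \<gamma> \<and> \<gamma> \<circ> B = B' \<circ> \<gamma> \<and>
           (\<forall>i. \<gamma> \<circ> E i = E' i \<circ> \<gamma> \<and> \<gamma> \<circ> F i = F' i \<circ> \<gamma>)"
proof -
  interpret V: td_irreducible s A B E F \<theta> \<phi> d by fact
  interpret W: td_irreducible s' A' B' E' F' \<theta> \<phi> d by fact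
  interpret N: td_module "prod_scale s s'" "map_prod A A'" "map_prod B B'"
      "\<lambda>i. map_prod (E i) (E' i)" "\<lambda>i. map_prod (F i) (F' i)" \<theta> \<phi> d
    by (intro td_module.intro block_tridiagonal_map_prod
        V.P.block_tridiagonal_axioms W.P.block_tridiagonal_axioms vector_space_prod_scale
        V.D.block_tridiagonal_axioms W.D.block_tridiagonal_axioms
        V.vector_space_axioms W.vector_space_axioms)
  define M where "M = N.span (N.word N.root (v, w) ` {ns. sorted ns})"
  have vw: "map_prod (F 0) (F' 0) (v, w) = (v, w)" using v w by simp
  have sub: "N.subspace M" by (simp add: M_def)
  have M_0: "(0, 0) \<in> M" using N.subspace_0[OF sub] by (simp add: zero_prod_def)
  have M_add: "(x + x', y + y') \<in> M" if "(x, y) \<in> M" "(x', y') \<in> M" for x x' y y'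
    using N.subspace_add[OF sub that] by simp
  have M_diff: "(x - x', y - y') \<in> M" if "(x, y) \<in> M" "(x', y') \<in> M" for x x' y y'
    using N.subspace_diff[OF sub that] by simp
  have M_scale: "(s c x, s' c y) \<in> M" if "(x, y) \<in> M" for c x y
    using N.subspace_scale[OF sub that, of c] by simp
  have M_A': "map_prod A A' p \<in> M" and M_B': "map_prod B B' p \<in> M" if "p \<in> M" for p
    using N.sorted_words_closed[OF vw that[unfolded M_def], of 0]
      N.sorted_words_closed[OF vw that[unfolded M_def], of 1]
    by (simp_all add: M_def N.letter_def)
  have M_A: "(A x, A' y) \<in> M" and M_B: "(B x, B' y) \<in> M" if "(x, y) \<in> M" for x y
    using M_A'[OF that] M_B'[OF that] by simp_all
  have M_E: "(E i x, E' i y) \<in> M" and M_F: "(F i x, F' i y) \<in> M" if "(x, y) \<in> M" for x y i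
    using N.P.E_mem_invariant_subspace[OF sub M_A' that, of i]
      N.D.E_mem_invariant_subspace[OF sub M_B' that, of i] by simp_all
  have "N.word N.root (v, w) [] \<in> M" unfolding M_def
    by (intro N.span_base image_eqI[of _ _ "[]"]) simp_all
  then have vw_M: "(v, w) \<in> M" by simp
  have E0: "\<exists>c. E 0 x = s c (E 0 v) \<and> E' 0 y = s' c (E' 0 w)" if "(x, y) \<in> M" for x y
  proof -
    have "\<exists>z. N.shifts (map_prod B B') (map \<phi> [1..<m + 1])
        (N.shifts (map_prod A A') (map \<theta> (rev [0..<m])) (v, w)) = prod_scale s s' z (v, w)" for m
      using eig[of m]
      by (simp add: shifts_map_prod[OF V.vector_space_axioms W.vector_space_axioms] del: upt_Suc)
    from N.E0_sorted_words[OF vw this that[unfolded M_def]] show ?thesis by simp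
  qed
  have E0_v: "E 0 v \<noteq> 0" and E0_w: "E' 0 w \<noteq> 0"
    using V.E0_injective[OF v(1)] W.E0_injective[OF w(1)] v w by auto
  have right_0: "y = 0" if "(0, y) \<in> M" for y
  proof -
    let ?K = "{y. (0, y) \<in> M}"
    have "W.subspace ?K"
      unfolding W.subspace_def using M_0 M_add[of 0 _ 0] M_scale[of 0] by auto
    then have "?K = {0} \<or> ?K = UNIV"
      using M_A[of 0] M_B[of 0] by (intro W.irreducible) auto
    \<comment> \<open>The first coordinate forces the scalar from \<open>E0\<close> to be 0, and
      then the second one would make \<open>E' 0 w\<close> vanish.\<close>
    moreover have "w \<notin> ?K" using E0[of 0 w] E0_v E0_w by (auto simp: V.P.E.zero)
    ultimately show ?thesis using that by auto
  qed
  have left_0: "x = 0" if "(x, 0) \<in> M" for x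
  proof -
    let ?K = "{x. (x, 0) \<in> M}"
    have "V.subspace ?K"
      unfolding V.subspace_def using M_0 M_add[of _ 0 _ 0] M_scale[of _ 0] by auto
    then have "?K = {0} \<or> ?K = UNIV"
      using M_A[of _ 0] M_B[of _ 0] by (intro V.irreducible) auto
    moreover have "v \<notin> ?K" using E0[of v 0] E0_v E0_w by (auto simp: W.P.E.zero)
    ultimately show ?thesis using that by auto
  qed
  have dom: "\<exists>y. (x, y) \<in> M" for x
  proof -
    let ?K = "{x. \<exists>y. (x, y) \<in> M}"
    have "V.subspace ?K" unfolding V.subspace_def using M_0 M_add M_scale by blast
    then have "?K = {0} \<or> ?K = UNIV" using M_A M_B by (intro V.irreducible) blast+
    with vw_M v(2) show ?thesis by blast
  qed
  have ran: "\<exists>x. (x, y) \<in> M" for y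
  proof -
    let ?K = "{y. \<exists>x. (x, y) \<in> M}"
    have "W.subspace ?K" unfolding W.subspace_def using M_0 M_add M_scale by blast
    then have "?K = {0} \<or> ?K = UNIV" using M_A M_B by (intro W.irreducible) blast+
    with vw_M w(2) show ?thesis by blast
  qed
  define \<gamma> where "\<gamma> x = (THE y. (x, y) \<in> M)" for x
  have uniq: "y = y'" if "(x, y) \<in> M" "(x, y') \<in> M" for x y y'
    using right_0[of "y - y'"] M_diff[OF that] by simp
  have \<gamma>: "\<gamma> x = y \<longleftrightarrow> (x, y) \<in> M" for x y
    unfolding \<gamma>_def using dom[of x] uniq[of x] by (metis theI)
  have \<gamma>_M: "(x, \<gamma> x) \<in> M" for x using \<gamma> by blast
  have "inj \<gamma>"
  proof (rule injI)
    fix x x' assume "\<gamma> x = \<gamma> x'"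
    then have "(x - x', 0) \<in> M" using M_diff[OF \<gamma>_M[of x] \<gamma>_M[of x']] by simp
    from left_0[OF this] show "x = x'" by simp
  qed
  moreover have "surj \<gamma>" using ran \<gamma> by (metis surjI)
  \<comment> \<open>Through \<open>\<gamma>\<close> every equation becomes a membership in
    \<open>M\<close>, and the closure properties of \<open>M\<close> supply it.\<close>
  moreover have "Vector_Spaces.linear s s' \<gamma>"
    by unfold_locales (auto simp: \<gamma> intro: M_add M_scale \<gamma>_M)
  moreover have "\<gamma> (A x) = A' (\<gamma> x)" "\<gamma> (B x) = B' (\<gamma> x)" "\<gamma> (E i x) = E' i (\<gamma> x)"
      "\<gamma> (F i x) = F' i (\<gamma> x)" for x i
    by (auto simp: \<gamma> intro: M_A M_B M_E M_F \<gamma>_M)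
  ultimately show ?thesis by (auto simp: bij_def fun_eq_iff)
qed

section \<open>Idempotents, sharpness and the split sequence\<close>

text \<open>A system leaves its idempotents beyond the diameter unspecified; \<open>cut d\<close> makes them zero.\<close>

definition cut :: "nat \<Rightarrow> (nat \<Rightarrow> 'b \<Rightarrow> 'b) \<Rightarrow> nat \<Rightarrow> 'b \<Rightarrow> 'b::zero" where
  "cut d E i = (if i \<le> d then E i else (\<lambda>_. 0))"

lemma comp_list_append: "comp_list (fs @ gs) = comp_list fs \<circ> comp_list gs"
  by (induction fs) (simp_all add: comp_list_def o_assoc)

context vector_space
begin

lemma eigenvalue_on_eq:
  assumes "x \<in> W" "x \<noteq> 0" "\<And>v. v \<in> W \<Longrightarrow> T v = t *s v"
  shows "eigenvalue_on T W = t"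
  unfolding eigenvalue_on_def
proof (rule the_equality)
  fix t' assume "\<forall>v\<in>W. T v = t' *s v"
  then have "t' *s x = t *s x" using assms by metis
  then show "t' = t" using assms(2) by simp
qed (use assms(3) in blast)

section \<open>From a standard ordering of eigenspaces to the block tridiagonal identities\<close>

context
  fixes A B :: "'b \<Rightarrow> 'b" and d :: nat and V :: "nat \<Rightarrow> 'b set" and E :: "nat \<Rightarrow> 'b \<Rightarrow> 'b"
  assumes linear: "Vector_Spaces.linear scale scale A" "Vector_Spaces.linear scale scale B"
    and diagonalizable: "diagonalizable A"
    and ordering: "standard_ordering A B d V"
    and idempotent: "\<And>i. i \<le> d \<Longrightarrow> primitive_idempotent A (V i) (E i)"
begin

interpretation A: Vector_Spaces.linear scale scale A by (rule linear)

lemma bij_V: "bij_betw V {..d} (eigenspaces A)"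
  using ordering by (simp add: standard_ordering_def)

lemma linear_cut: "Vector_Spaces.linear scale scale (cut d E i)"
proof (cases "i \<le> d")
  case True
  then show ?thesis using idempotent[of i] by (simp add: cut_def primitive_idempotent_def)
next
  case False
  then show ?thesis by unfold_locales (simp_all add: cut_def)
qed

lemma V_eigenspace:
  assumes "i \<le> d"
  shows "V i \<noteq> {0}" "\<exists>t. V i = {v. A v = t *s v}"
  using bij_betwE[OF bij_V] assms by (auto simp: eigenspaces_def)

lemma subspace_V:
  assumes "i \<le> d"
  shows "subspace (V i)"
proof -
  obtain t where "V i = {v. A v = t *s v}" using V_eigenspace[OF assms] by blast
  then show ?thesis
    by (auto simp: subspace_def A.add A.scale scale_right_distrib scale_left_commute)
qed

lemma cut_V:
  assumes "x \<in> V j" "j \<le> d"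
  shows "cut d E i x = (if i = j then x else 0)"
proof (cases "i = j \<or> d < i")
  case False
  then have "V j \<in> eigenspaces A - {V i}"
    using bij_V assms(2) by (auto simp: bij_betw_def dest: inj_onD)
  then show ?thesis using idempotent[of i] assms(1) False
    by (simp add: cut_def primitive_idempotent_def)
next
  case True
  then show ?thesis using idempotent[of j] assms
    by (auto simp: cut_def primitive_idempotent_def)
qed

lemma span_V: "span (\<Union>i\<le>d. V i) = UNIV"
  using diagonalizable bij_V by (simp add: diagonalizable_def bij_betw_def)

lemma cut_in_V:
  assumes "i \<le> d"
  shows "cut d E i x \<in> V i"
proof (rule linear_into_subspace[OF linear_cut subspace_V[OF assms]])
  show "x \<in> span (\<Union>i\<le>d. V i)" by (simp add: span_V)
  show "cut d E i ` (\<Union>i\<le>d. V i) \<subseteq> V i"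
    using assms by (auto simp: cut_V subspace_0 subspace_V)
qed

lemma range_idempotent:
  assumes "i \<le> d"
  shows "range (E i) = V i"
proof
  show "range (E i) \<subseteq> V i" using cut_in_V[OF assms] assms by (auto simp: cut_def)
  show "V i \<subseteq> range (E i)"
  proof
    fix x assume "x \<in> V i"
    then have "E i x = x" using cut_V[of x i i] assms by (simp add: cut_def)
    then show "x \<in> range (E i)" by (metis rangeI)
  qed
qed

lemma range_idempotent_nonzero:
  assumes "i \<le> d"
  obtains x where "x \<in> V i" "x \<noteq> 0"
  using V_eigenspace(1)[OF assms] subspace_0[OF subspace_V[OF assms]] by blast

lemma block_tridiagonal_cut:
  assumes \<theta>: "\<And>i. i \<le> d \<Longrightarrow> \<theta> i = eigenvalue_on A (range (E i))"
  shows "block_tridiagonal scale A B (cut d E) \<theta> d"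
proof -
  have V_eq: "V i = {v. A v = \<theta> i *s v}" if i: "i \<le> d" for i
  proof -
    obtain t where t: "V i = {v. A v = t *s v}" using V_eigenspace[OF i] by blast
    obtain x where "x \<in> V i" "x \<noteq> 0" using range_idempotent_nonzero[OF i] .
    then have "eigenvalue_on A (V i) = t" using t by (intro eigenvalue_on_eq) auto
    then show ?thesis using t \<theta>[OF i] by (simp add: range_idempotent[OF i])
  qed
  interpret E: Vector_Spaces.linear scale scale "cut d E i" for i by (rule linear_cut)
  show ?thesis
  proof (intro block_tridiagonal.intro block_tridiagonal_axioms.intro)
    fix i j x
    show "vector_space scale" by unfold_locales
    show "(\<Sum>i\<le>d. cut d E i x) = x"
    proof -
      \<comment> \<open>The eigenspaces span, and this linear map vanishes on each of them.\<close>
      let ?f = "\<lambda>x. (\<Sum>i\<le>d. cut d E i x) - x"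
      have "Vector_Spaces.linear scale scale ?f"
        by unfold_locales
          (simp_all add: E.add E.scale sum.distrib scale_sum_right scale_right_diff_distrib algebra_simps)
      moreover have "?f ` (\<Union>i\<le>d. V i) \<subseteq> {0}" by (auto simp: cut_V)
      ultimately have "?f x \<in> {0}"
        by (rule linear_into_subspace[OF _ subspace_single_0]) (simp add: span_V)
      then show ?thesis by simp
    qed
    show "cut d E i (cut d E j x) = (if i = j then cut d E i x else 0)"
    proof (cases "j \<le> d")
      case True
      then show ?thesis by (simp add: cut_V[OF cut_in_V])
    next
      case False
      then show ?thesis by (simp add: cut_def[of d E j] E.zero)
    qed
    show "d < i \<Longrightarrow> cut d E i x = 0" by (simp add: cut_def)
    show "A (cut d E i x) = \<theta> i *s cut d E i x"
    proof (cases "i \<le> d")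
      case True
      then show ?thesis using cut_in_V[OF True] V_eq[OF True] by blast
    next
      case False
      then show ?thesis by (simp add: cut_def A.zero)
    qed
    show "inj_on \<theta> {..d}"
    proof (rule inj_onI)
      fix i j assume "i \<in> {..d}" "j \<in> {..d}" "\<theta> i = \<theta> j"
      moreover from this have "V i = V j" by (simp add: V_eq)
      ultimately show "i = j" using bij_V by (auto simp: bij_betw_def dest: inj_onD)
    qed
    show "cut d E i (B (cut d E j x)) = 0" if ij: "i + 1 < j \<or> j + 1 < i"
    proof (cases "j \<le> d")
      case True
      have "B ` V j \<subseteq> (if j = 0 then {0} else V (j - 1)) + V j + (if j = d then {0} else V (j + 1))"
        using ordering True by (simp add: standard_ordering_def)
      then have "B (cut d E j x) \<in> (if j = 0 then {0} else V (j - 1)) + V j + (if j = d then {0} else V (j + 1))"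
        using cut_in_V[OF True] by blast
      then obtain a b c where abc: "B (cut d E j x) = a + b + c"
        "a \<in> (if j = 0 then {0} else V (j - 1))" "b \<in> V j" "c \<in> (if j = d then {0} else V (j + 1))"
        by (elim set_plus_elim) blast
      have "cut d E i a = 0" using abc(2) ij True cut_V[of a "j - 1" i] by (auto simp: split: if_splits)
      moreover have "cut d E i b = 0" using abc(3) ij True cut_V[of b j i] by auto
      moreover have "cut d E i c = 0"
        using abc(4) ij True cut_V[of c "j + 1" i] by (auto simp: split: if_splits)
      ultimately show ?thesis by (simp add: abc(1) E.add)
    next
      case False
      interpret B: Vector_Spaces.linear scale scale B by (rule linear)
      show ?thesis using False by (simp add: cut_def[of d E j] E.zero B.zero)
    qed
  qed (intro linear linear_cut)+
qed

end

lemma td_irreducible_cut: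
  assumes pair: "tridiagonal_pair A B"
    and E: "standard_idempotents A B d E" and F: "standard_idempotents B A d F"
    and \<theta>: "\<And>i. i \<le> d \<Longrightarrow> \<theta> i = eigenvalue_on A (range (E i))"
    and \<phi>: "\<And>i. i \<le> d \<Longrightarrow> \<phi> i = eigenvalue_on B (range (F i))"
  shows "td_irreducible scale A B (cut d E) (cut d F) \<theta> \<phi> d"
proof -
  have lin: "Vector_Spaces.linear scale scale A" "Vector_Spaces.linear scale scale B"
    and diag: "diagonalizable A" "diagonalizable B"
    and irr: "subspace W \<Longrightarrow> A ` W \<subseteq> W \<Longrightarrow> B ` W \<subseteq> W \<Longrightarrow> W = {0} \<or> W = UNIV" for W
    using pair by (auto simp: tridiagonal_pair_def)
  obtain V where V: "standard_ordering A B d V" "\<And>i. i \<le> d \<Longrightarrow> primitive_idempotent A (V i) (E i)"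
    using E by (auto simp: standard_idempotents_def)
  obtain V' where V': "standard_ordering B A d V'" "\<And>i. i \<le> d \<Longrightarrow> primitive_idempotent B (V' i) (F i)"
    using F by (auto simp: standard_idempotents_def)
  obtain x where "x \<in> V 0" "x \<noteq> 0"
    using range_idempotent_nonzero[OF lin diag(1) V, of 0] by blast
  then have "cut d E 0 x \<noteq> 0" using cut_V[OF lin diag(1) V, of x 0 0] by simp
  moreover have "td_module scale A B (cut d E) (cut d F) \<theta> \<phi> d"
    using block_tridiagonal_cut[OF lin diag(1) V \<theta>] block_tridiagonal_cut[OF lin(2,1) diag(2) V' \<phi>]
    by (intro td_module.intro vector_space_axioms)
  ultimately show ?thesis
    using irr by (intro td_irreducible.intro td_irreducible_axioms.intro) (auto simp: image_subset_iff)
qed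

lemma dim_1_singleton_basis:
  assumes "dim W = 1"
  obtains b where "W \<subseteq> span {b}"
proof -
  obtain X where "W \<subseteq> span X" "card X = dim W" using basis_exists[of W] by blast
  with assms have "card X = 1" by simp
  then obtain b where "X = {b}" by (rule card_1_singletonE)
  with \<open>W \<subseteq> span X\<close> that show ?thesis by blast
qed

text \<open>
  Sharpness is stated for some standard ordering of the eigenspaces of \<open>A\<close>. Applying the injectivity
  of the first idempotent to that ordering makes its identification with the given one unnecessary.
\<close>

lemma sharp_dual_idem_0:
  assumes sharp: "sharp_tridiagonal_system \<Phi>"
  obtains v where "v \<noteq> 0" "range (dual_idem \<Phi> 0) = span {v}" "dual_idem \<Phi> 0 v = v"
proof -
  let ?A = "endo \<Phi>" and ?B = "dual_endo \<Phi>" and ?d = "diam \<Phi>" and ?F = "dual_idem \<Phi>"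
  have pair: "tridiagonal_pair ?A ?B" and E: "standard_idempotents ?A ?B ?d (idem \<Phi>)"
    and F: "standard_idempotents ?B ?A ?d ?F" and "sharp_pair ?A ?B"
    using sharp by (auto simp: sharp_tridiagonal_system_def tridiagonal_system_def)
  then obtain d' V' where V': "standard_ordering ?A ?B d' V'" "dim (V' 0) = 1"
    by (auto simp: sharp_pair_def)
  have lin: "Vector_Spaces.linear scale scale ?A" "Vector_Spaces.linear scale scale ?B"
    and diag: "diagonalizable ?A" "diagonalizable ?B"
    using pair by (auto simp: tridiagonal_pair_def)
  obtain V where V: "standard_ordering ?A ?B ?d V" "\<And>i. i \<le> ?d \<Longrightarrow> primitive_idempotent ?A (V i) (idem \<Phi> i)"
    using E by (auto simp: standard_idempotents_def)
  obtain U where U: "standard_ordering ?B ?A ?d U" "\<And>i. i \<le> ?d \<Longrightarrow> primitive_idempotent ?B (U i) (?F i)"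
    using F by (auto simp: standard_idempotents_def)
  have bij: "bij_betw V {..?d} (eigenspaces ?A)" "bij_betw V' {..d'} (eigenspaces ?A)"
    using V(1) V'(1) by (simp_all add: standard_ordering_def)
  have d': "d' = ?d" using bij_betw_same_card[OF bij(1)] bij_betw_same_card[OF bij(2)] by simp
  \<comment> \<open>The given idempotents are reindexed along the ordering that witnesses sharpness;
    the dual side stays as it is.\<close>
  define \<sigma> where "\<sigma> i = inv_into {..?d} V (V' i)" for i
  have \<sigma>: "\<sigma> i \<le> ?d" "V (\<sigma> i) = V' i" if "i \<le> ?d" for i
  proof -
    have "V' i \<in> V ` {..?d}" using bij that d' by (auto simp: bij_betw_def)
    from inv_into_into[OF this] f_inv_into_f[OF this]
    show "\<sigma> i \<le> ?d" "V (\<sigma> i) = V' i" by (simp_all add: \<sigma>_def)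
  qed
  have idem': "primitive_idempotent ?A (V' i) (idem \<Phi> (\<sigma> i))" if "i \<le> ?d" for i
    using V(2)[OF \<sigma>(1)[OF that]] \<sigma>(2)[OF that] by simp
  then have "standard_idempotents ?A ?B ?d (\<lambda>i. idem \<Phi> (\<sigma> i))"
    using V'(1) d' by (auto simp: standard_idempotents_def)
  then interpret td_irreducible scale ?A ?B "cut ?d (\<lambda>i. idem \<Phi> (\<sigma> i))" "cut ?d ?F"
      "\<lambda>i. eigenvalue_on ?A (range (idem \<Phi> (\<sigma> i)))" "\<lambda>i. eigenvalue_on ?B (range (?F i))" ?d
    using F by (intro td_irreducible_cut[OF pair]) auto
  have F0: "cut ?d ?F 0 x = x \<longleftrightarrow> x \<in> U 0" for x
    using cut_V[OF lin(2,1) diag(2) U, of x 0 0] cut_in_V[OF lin(2,1) diag(2) U, of 0 x] by force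
  have range: "range (?F 0) = U 0"
    by (rule range_idempotent[OF lin(2,1) diag(2) U]) simp_all
  let ?E0 = "cut ?d (\<lambda>i. idem \<Phi> (\<sigma> i)) 0"
  have E0: "?E0 x \<in> V' 0" for x
    using cut_in_V[OF lin diag(1) V'(1)[unfolded d'] idem'] by simp
  obtain b where b: "V' 0 \<subseteq> span {b}" using dim_1_singleton_basis[OF V'(2)] .
  obtain v where v: "v \<in> U 0" "v \<noteq> 0" using range_idempotent_nonzero[OF lin(2,1) diag(2) U, of 0] by blast
  obtain r where r: "?E0 v = r *s b" using E0 b by (auto simp: span_singleton)
  then have "r \<noteq> 0" using E0_injective F0 v by auto
  have "y \<in> span {v}" if y: "y \<in> U 0" for y
  proof -
    obtain c where c: "?E0 y = c *s b" using E0 b by (auto simp: span_singleton)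
    \<comment> \<open>The coefficient cancels the image under \<open>?E0\<close>, so injectivity on
      the dual eigenspace \<open>U 0\<close> makes the difference zero.\<close>
    let ?x = "y - (c / r) *s v"
    have "?E0 ?x = 0" using \<open>r \<noteq> 0\<close> by (simp add: P.E.diff P.E.scale r c)
    moreover have "cut ?d ?F 0 ?x = ?x" using y v by (simp add: D.E.diff D.E.scale flip: F0)
    ultimately have "?x = 0" by (rule E0_injective[rotated])
    then show ?thesis by (auto simp: span_singleton)
  qed
  moreover have "span {v} \<subseteq> U 0"
    using v(1) by (intro span_minimal subspace_V[OF lin(2,1) diag(2) U]) auto
  ultimately have "range (?F 0) = span {v}" using range by blast
  moreover have "?F 0 v = v" using F0[of v] v by (simp add: cut_def)
  ultimately show ?thesis using that v(2) by blast
qed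

section \<open>The split sequence as eigenvalues on U_0\<close>

lemma split_seq_shifts:
  "split_seq \<Phi> i = eigenvalue_on
     (shifts (dual_endo \<Phi>) (map (dual_eigval \<Phi>) [1..<i + 1]) \<circ>
       shifts (endo \<Phi>) (map (eigval \<Phi>) (rev [0..<i])))
     (split_space \<Phi> 0)"
  by (simp only: split_seq_def shifts_def comp_list_append map_map o_def)

text \<open>\<open>\<theta>\<close> and \<open>\<phi>\<close> are prescribed only up to the
  diameter, so that two systems with equal parameter arrays become instances with the very same
  sequences.\<close>

lemma tridiagonal_system_irreducible:
  assumes "tridiagonal_system \<Phi>"
    and "\<And>i. i \<le> diam \<Phi> \<Longrightarrow> \<theta> i = eigval \<Phi> i" "\<And>i. i \<le> diam \<Phi> \<Longrightarrow> \<phi> i = dual_eigval \<Phi> i"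
  shows "td_irreducible scale (endo \<Phi>) (dual_endo \<Phi>)
    (cut (diam \<Phi>) (idem \<Phi>)) (cut (diam \<Phi>) (dual_idem \<Phi>)) \<theta> \<phi> (diam \<Phi>)"
  using assms by (intro td_irreducible_cut)
    (auto simp: tridiagonal_system_def eigval_def dual_eigval_def)

text \<open>The second space of the intersection is everything, because the idempotents sum to the
  identity.\<close>

lemma split_space_0:
  assumes "tridiagonal_system \<Phi>"
  shows "split_space \<Phi> 0 = range (dual_idem \<Phi> 0)"
proof -
  interpret td_irreducible scale "endo \<Phi>" "dual_endo \<Phi>" "cut (diam \<Phi>) (idem \<Phi>)"
      "cut (diam \<Phi>) (dual_idem \<Phi>)" "eigval \<Phi>" "dual_eigval \<Phi>" "diam \<Phi>"
    by (rule tridiagonal_system_irreducible[OF assms]) simp_all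
  have "x \<in> (\<Sum>j\<in>{0..diam \<Phi>}. range (idem \<Phi> j))" for x
  proof -
    have "x = (\<Sum>j\<in>{0..diam \<Phi>}. cut (diam \<Phi>) (idem \<Phi>) j x)"
      by (simp add: P.sum_E atLeast0AtMost)
    also have "\<dots> = (\<Sum>j\<in>{0..diam \<Phi>}. idem \<Phi> j x)"
      by (intro sum.cong) (auto simp: cut_def)
    finally show ?thesis by (subst set_sum_alt) auto
  qed
  then show ?thesis by (auto simp: split_space_def)
qed

text \<open>Climbing m steps and descending again leads back to the line through v. Beyond the
  diameter the climb already gives 0, which yields an eigenvalue for every m, as
  \<open>word_height_0\<close> demands.\<close>

lemma split_seq_eigenvector:
  assumes sharp: "sharp_tridiagonal_system \<Phi>"
    and \<theta>: "\<And>i. i \<le> diam \<Phi> \<Longrightarrow> \<theta> i = eigval \<Phi> i"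
    and \<phi>: "\<And>i. i \<le> diam \<Phi> \<Longrightarrow> \<phi> i = dual_eigval \<Phi> i"
    and v: "v \<noteq> 0" "range (dual_idem \<Phi> 0) = span {v}" "dual_idem \<Phi> 0 v = v"
  shows "shifts (dual_endo \<Phi>) (map \<phi> [1..<m + 1]) (shifts (endo \<Phi>) (map \<theta> (rev [0..<m])) v) =
    (if m \<le> diam \<Phi> then split_seq \<Phi> m else 0) *s v"
proof -
  let ?L = "shifts (dual_endo \<Phi>) (map \<phi> [1..<m + 1])"
  let ?R = "shifts (endo \<Phi>) (map \<theta> (rev [0..<m]))"
  have sys: "tridiagonal_system \<Phi>" using sharp by (simp add: sharp_tridiagonal_system_def)
  interpret td_irreducible scale "endo \<Phi>" "dual_endo \<Phi>" "cut (diam \<Phi>) (idem \<Phi>)"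
      "cut (diam \<Phi>) (dual_idem \<Phi>)" \<theta> \<phi> "diam \<Phi>"
    by (rule tridiagonal_system_irreducible[OF sys \<theta> \<phi>])
  interpret L: Vector_Spaces.linear scale scale ?L by (rule linear_shifts[OF D.linear_A])
  interpret R: Vector_Spaces.linear scale scale ?R by (rule linear_shifts[OF P.linear_A])
  have "v \<in> split 0" using v by (simp add: split_0 cut_def)
  from raise_split_power[OF this, of m] have R_split: "?R v \<in> split m" by simp
  show ?thesis
  proof (cases "m \<le> diam \<Phi>")
    case True
    from lower_split_power[OF R_split, of m] have "?L (?R v) \<in> split 0"
      by (simp only: map_lower_indices) simp
    then have "dual_idem \<Phi> 0 (?L (?R v)) = ?L (?R v)" by (simp add: split_0 cut_def)
    then have "?L (?R v) \<in> span {v}" using v(2) by (metis rangeI)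
    then obtain z where z: "?L (?R v) = z *s v" by (auto simp: span_singleton)
    have "map \<theta> (rev [0..<m]) = map (eigval \<Phi>) (rev [0..<m])"
      "map \<phi> [1..<m + 1] = map (dual_eigval \<Phi>) [1..<m + 1]"
      using True \<theta> \<phi> by (auto simp del: upt_Suc)
    then have "split_seq \<Phi> m = eigenvalue_on (?L \<circ> ?R) (span {v})"
      by (simp only: split_seq_shifts split_space_0[OF sys] v(2))
    also have "\<dots> = z"
    proof (rule eigenvalue_on_eq)
      show "v \<in> span {v}" by (simp add: span_base)
      show "v \<noteq> 0" by fact
      show "(?L \<circ> ?R) x = z *s x" if x: "x \<in> span {v}" for x
      proof -
        from x obtain r where "x = r *s v" by (auto simp: span_singleton)
        then show ?thesis by (simp only: o_def L.scale R.scale z scale_left_commute)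
      qed
    qed
    finally show ?thesis using z True by simp
  next
    case False
    then have "?R v = 0" using split_above[OF _ R_split] by simp
    then show ?thesis using False L.zero by simp
  qed
qed

end

section \<open>Invariance of the parameter array under isomorphism, and the converse\<close>

lemma eigenvalue_on_transport:
  assumes "Vector_Spaces.linear s s' \<gamma>" "inj \<gamma>" "\<gamma> \<circ> T = T' \<circ> \<gamma>"
  shows "vector_space.eigenvalue_on s' T' (\<gamma> ` W) = vector_space.eigenvalue_on s T W"
proof -
  interpret \<gamma>: Vector_Spaces.linear s s' \<gamma> by fact
  have "T' (\<gamma> x) = s' t (\<gamma> x) \<longleftrightarrow> T x = s t x" for t x
  proof -
    have "T' (\<gamma> x) = \<gamma> (T x)" using assms(3) by (metis comp_apply)
    then show ?thesis using assms(2) by (simp add: inj_eq flip: \<gamma>.scale)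
  qed
  \<comment> \<open>The predicates under the two \<open>THE\<close> operators agree for every
    scalar, so existence and uniqueness do not enter.\<close>
  then show ?thesis by (simp add: \<gamma>.vs1.eigenvalue_on_def \<gamma>.vs2.eigenvalue_on_def)
qed

lemma shifts_transport:
  assumes "Vector_Spaces.linear s s' \<gamma>" "\<gamma> \<circ> T = T' \<circ> \<gamma>"
  shows "\<gamma> \<circ> vector_space.shifts s T cs = vector_space.shifts s' T' cs \<circ> \<gamma>"
proof -
  interpret \<gamma>: Vector_Spaces.linear s s' \<gamma> by fact
  have "\<gamma> (T x) = T' (\<gamma> x)" for x using assms(2) by (metis comp_apply)
  then have "\<gamma> (\<gamma>.vs1.shifts T cs x) = \<gamma>.vs2.shifts T' cs (\<gamma> x)" for x
    by (induction cs) (simp_all add: \<gamma>.diff \<gamma>.scale)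
  then show ?thesis by (simp add: fun_eq_iff)
qed

lemma range_transport:
  assumes "surj \<gamma>" "\<gamma> \<circ> f = g \<circ> \<gamma>"
  shows "range g = \<gamma> ` range f"
  using assms by (metis image_comp)

lemma td_isomorphic_parameter_array:
  assumes "vector_space s" "vector_space s'"
    and sys: "vector_space.tridiagonal_system s \<Phi>" "vector_space.tridiagonal_system s' \<Phi>'"
    and iso: "td_isomorphic s s' \<Phi> \<Phi>'"
  shows "vector_space.parameter_array s \<Phi> = vector_space.parameter_array s' \<Phi>'"
proof -
  interpret V: vector_space s by fact
  interpret W: vector_space s' by fact
  obtain \<gamma> where d: "diam \<Phi> = diam \<Phi>'" and lin: "Vector_Spaces.linear s s' \<gamma>" and "bij \<gamma>"
    and AB: "\<gamma> \<circ> endo \<Phi> = endo \<Phi>' \<circ> \<gamma>" "\<gamma> \<circ> dual_endo \<Phi> = dual_endo \<Phi>' \<circ> \<gamma>"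
    and EF: "\<And>i. i \<le> diam \<Phi> \<Longrightarrow> \<gamma> \<circ> idem \<Phi> i = idem \<Phi>' i \<circ> \<gamma>"
      "\<And>i. i \<le> diam \<Phi> \<Longrightarrow> \<gamma> \<circ> dual_idem \<Phi> i = dual_idem \<Phi>' i \<circ> \<gamma>"
    using iso by (auto simp: td_isomorphic_def)
  then have inj: "inj \<gamma>" and surj: "surj \<gamma>" by (simp_all add: bij_def)
  have eig: "V.eigval \<Phi> i = W.eigval \<Phi>' i" "V.dual_eigval \<Phi> i = W.dual_eigval \<Phi>' i" if "i \<le> diam \<Phi>" for i
    using eigenvalue_on_transport[OF lin inj AB(1), of "range (idem \<Phi> i)"]
      eigenvalue_on_transport[OF lin inj AB(2), of "range (dual_idem \<Phi> i)"]
      range_transport[OF surj EF(1)[OF that]] range_transport[OF surj EF(2)[OF that]]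
    by (simp_all add: V.eigval_def W.eigval_def V.dual_eigval_def W.dual_eigval_def)
  have split: "W.split_space \<Phi>' 0 = \<gamma> ` V.split_space \<Phi> 0"
    using range_transport[OF surj EF(2)[of 0]] by (simp add: V.split_space_0[OF sys(1)] W.split_space_0[OF sys(2)])
  have "V.split_seq \<Phi> i = W.split_seq \<Phi>' i" if "i \<le> diam \<Phi>" for i
  proof -
    have maps: "map (V.eigval \<Phi>) (rev [0..<i]) = map (W.eigval \<Phi>') (rev [0..<i])"
      "map (V.dual_eigval \<Phi>) [1..<i + 1] = map (W.dual_eigval \<Phi>') [1..<i + 1]"
      using eig that by (auto simp del: upt_Suc)
    have "\<gamma> \<circ> (V.shifts (dual_endo \<Phi>) cs \<circ> V.shifts (endo \<Phi>) cs') =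
        (W.shifts (dual_endo \<Phi>') cs \<circ> W.shifts (endo \<Phi>') cs') \<circ> \<gamma>" for cs cs'
      using shifts_transport[OF lin AB(1)] shifts_transport[OF lin AB(2)] by (metis comp_assoc)
    from eigenvalue_on_transport[OF lin inj this] show ?thesis
      by (simp only: V.split_seq_shifts W.split_seq_shifts split maps)
  qed
  with eig d show ?thesis by (auto simp: V.parameter_array_def W.parameter_array_def)
qed

theorem theorem1p6:
  fixes scaleV :: "'k::field \<Rightarrow> 'v::ab_group_add \<Rightarrow> 'v"
    and scaleW :: "'k \<Rightarrow> 'w::ab_group_add \<Rightarrow> 'w"
    and BV :: "'v set" and BW :: "'w set"
    and \<Phi> :: "'v td_data" and \<Phi>' :: "'w td_data"
  assumes "finite_dimensional_vector_space scaleV BV"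
    and "vector_space.dim scaleV UNIV > 0"
    and "finite_dimensional_vector_space scaleW BW"
    and "vector_space.dim scaleW UNIV > 0"
    and "vector_space.sharp_tridiagonal_system scaleV \<Phi>"
    and "vector_space.sharp_tridiagonal_system scaleW \<Phi>'"
  shows "td_isomorphic scaleV scaleW \<Phi> \<Phi>' \<longleftrightarrow>
    vector_space.parameter_array scaleV \<Phi> = vector_space.parameter_array scaleW \<Phi>'"
proof -
  interpret V: vector_space scaleV
    using assms(1) by (simp add: finite_dimensional_vector_space_def)
  interpret W: vector_space scaleW
    using assms(3) by (simp add: finite_dimensional_vector_space_def)
  have sys: "V.tridiagonal_system \<Phi>" "W.tridiagonal_system \<Phi>'"
    using assms(5,6) by (simp_all add: V.sharp_tridiagonal_system_def W.sharp_tridiagonal_system_def)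
  show ?thesis
  proof
    assume "td_isomorphic scaleV scaleW \<Phi> \<Phi>'"
    then show "V.parameter_array \<Phi> = W.parameter_array \<Phi>'"
      using td_isomorphic_parameter_array[OF V.vector_space_axioms W.vector_space_axioms sys] by blast
  next
    assume array: "V.parameter_array \<Phi> = W.parameter_array \<Phi>'"
    \<comment> \<open>The eigenvalue sequences of \<open>\<Phi>\<close> are used for both systems;
      they agree with those of \<open>\<Phi>'\<close> up to the diameter.\<close>
    let ?\<theta> = "V.eigval \<Phi>" and ?\<phi> = "V.dual_eigval \<Phi>"
    have maps: "map (V.eigval \<Phi>) [0..<diam \<Phi> + 1] = map (W.eigval \<Phi>') [0..<diam \<Phi>' + 1]"
        "map (V.dual_eigval \<Phi>) [0..<diam \<Phi> + 1] = map (W.dual_eigval \<Phi>') [0..<diam \<Phi>' + 1]"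
        "map (V.split_seq \<Phi>) [0..<diam \<Phi> + 1] = map (W.split_seq \<Phi>') [0..<diam \<Phi>' + 1]"
      using array by (simp_all only: V.parameter_array_def W.parameter_array_def prod.inject)
    have d: "diam \<Phi> = diam \<Phi>'" using arg_cong[OF maps(1), of length] by simp
    have \<theta>: "?\<theta> i = W.eigval \<Phi>' i" and \<phi>: "?\<phi> i = W.dual_eigval \<Phi>' i"
      and \<zeta>: "V.split_seq \<Phi> i = W.split_seq \<Phi>' i" if "i \<le> diam \<Phi>'" for i
      using maps that unfolding d map_eq_conv by auto
    obtain v where v: "v \<noteq> 0" "range (dual_idem \<Phi> 0) = V.span {v}" "dual_idem \<Phi> 0 v = v"
      using V.sharp_dual_idem_0[OF assms(5)] .
    obtain w where w: "w \<noteq> 0" "range (dual_idem \<Phi>' 0) = W.span {w}" "dual_idem \<Phi>' 0 w = w"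
      using W.sharp_dual_idem_0[OF assms(6)] .
    \<comment> \<open>The common scalar: a member of the shared split sequence, continued by
      0.\<close>
    let ?z = "\<lambda>m. if m \<le> diam \<Phi>' then W.split_seq \<Phi>' m else 0"
    have "V.shifts (dual_endo \<Phi>) (map ?\<phi> [1..<m + 1]) (V.shifts (endo \<Phi>) (map ?\<theta> (rev [0..<m])) v) =
          scaleV (?z m) v" for m
      using V.split_seq_eigenvector[OF assms(5) refl refl v, of m] \<zeta>[of m]
      by (simp add: d del: upt_Suc)
    moreover have "W.shifts (dual_endo \<Phi>') (map ?\<phi> [1..<m + 1]) (W.shifts (endo \<Phi>') (map ?\<theta> (rev [0..<m])) w) =
          scaleW (?z m) w" for m
      by (rule W.split_seq_eigenvector[OF assms(6) \<theta> \<phi> w])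
    ultimately have eig: "\<exists>z. V.shifts (dual_endo \<Phi>) (map ?\<phi> [1..<m + 1])
            (V.shifts (endo \<Phi>) (map ?\<theta> (rev [0..<m])) v) = scaleV z v \<and>
          W.shifts (dual_endo \<Phi>') (map ?\<phi> [1..<m + 1])
            (W.shifts (endo \<Phi>') (map ?\<theta> (rev [0..<m])) w) = scaleW z w" for m
      by blast
    have "cut (diam \<Phi>) (dual_idem \<Phi>) 0 v = v" "cut (diam \<Phi>) (dual_idem \<Phi>') 0 w = w"
      using v w by (simp_all add: cut_def)
    with td_irreducible_isomorphism[OF V.tridiagonal_system_irreducible[OF sys(1) refl refl]
        W.tridiagonal_system_irreducible[OF sys(2) \<theta> \<phi>, folded d] _ v(1) _ w(1) eig]
    obtain \<gamma> where \<gamma>: "Vector_Spaces.linear scaleV scaleW \<gamma>" "bij \<gamma>"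
      "\<gamma> \<circ> endo \<Phi> = endo \<Phi>' \<circ> \<gamma>" "\<gamma> \<circ> dual_endo \<Phi> = dual_endo \<Phi>' \<circ> \<gamma>"
      "\<And>i. \<gamma> \<circ> cut (diam \<Phi>) (idem \<Phi>) i = cut (diam \<Phi>) (idem \<Phi>') i \<circ> \<gamma>"
      "\<And>i. \<gamma> \<circ> cut (diam \<Phi>) (dual_idem \<Phi>) i = cut (diam \<Phi>) (dual_idem \<Phi>') i \<circ> \<gamma>"
      by blast
    \<comment> \<open>Up to the diameter \<open>cut\<close> changes nothing.\<close>
    have "\<gamma> \<circ> idem \<Phi> i = idem \<Phi>' i \<circ> \<gamma> \<and> \<gamma> \<circ> dual_idem \<Phi> i = dual_idem \<Phi>' i \<circ> \<gamma>"
      if "i \<le> diam \<Phi>" for i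
      using \<gamma>(5,6)[of i] that by (simp add: cut_def)
    with \<gamma>(1-4) d show "td_isomorphic scaleV scaleW \<Phi> \<Phi>'"
      unfolding td_isomorphic_def by blast
  qed
qed

end
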